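(* Let $X$ be a complex linear space and let $B=\widetilde{F(X)}$. Then $\mathcal{T}_{Lie}(B)=\mathcal{N}_{Lie}(B)$.
   Context: $F(X)$ is the algebra of all finite-rank linear operators on $X$, and $\widetilde{F(X)}$ is its unitization, realized as $F(X)+\mathbb{C}1\subset\mathcal{L}(X)$, where $\mathcal{L}(X)$ is the algebra of all linear operators on $X$. For a unital associative algebra $B$, $B^{op}$ denotes the opposite algebra (same linear space, product $a*b=ba$), and $B\otimes B^{op}$ is the algebraic tensor product algebra. $\mathcal{T}_{Lie}(B)$ is the subalgebra (not required to contain the unit) of $B\otimes B^{op}$ generated by all elements $a\otimes 1-1\otimes a$, $a\in B$. $\mathcal{N}_{Lie}(B)$ is the subalgebra of $B\otimes B^{op}$ consisting of all tensors $\sum_k a_k\otimes b_k$ (finite sums) such that $\sum_k a_kb_k=0$ and $\sum_k b_ka_k=0$, the products being taken in $B$. *)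

theory Defs
  imports Complex_Main "HOL-Library.Poly_Mapping"
begin

section \<open>Complex vector spaces and unital associative algebras\<close>

class complex_vector = ab_group_add +
  fixes scaleC :: "complex \<Rightarrow> 'a \<Rightarrow> 'a"  (infixr "*\<^sub>C" 75)
  assumes scaleC_add_right: "a *\<^sub>C (x + y) = a *\<^sub>C x + a *\<^sub>C y"
    and scaleC_add_left: "(a + b) *\<^sub>C x = a *\<^sub>C x + b *\<^sub>C x"
    and scaleC_scaleC: "a *\<^sub>C b *\<^sub>C x = (a * b) *\<^sub>C x"
    and scaleC_one: "1 *\<^sub>C x = x"

global_interpretation cvec: vector_space "scaleC :: complex \<Rightarrow> 'a \<Rightarrow> 'a::complex_vector"
  by unfold_locales (rule scaleC_add_right scaleC_add_left scaleC_scaleC scaleC_one)+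

abbreviation clinear :: "('a::complex_vector \<Rightarrow> 'b::complex_vector) \<Rightarrow> bool"
  where "clinear \<equiv> Vector_Spaces.linear scaleC scaleC"

lemma clinear_iff:
  "clinear f \<longleftrightarrow> (\<forall>x y. f (x + y) = f x + f y) \<and> (\<forall>c x. f (c *\<^sub>C x) = c *\<^sub>C f x)"
  unfolding linear_iff_module_hom module_hom_def module_hom_axioms_def
  by (auto intro: cvec.module_axioms)

text \<open>
  \<open>ring_1\<close> is avoided below because it includes \<open>0 \<noteq> 1\<close>, which fails for operators
  on the zero space.
\<close>

class complex_algebra = complex_vector + ring +
  assumes mult_scaleC_left: "a *\<^sub>C x * y = a *\<^sub>C (x * y)"
    and mult_scaleC_right: "x * a *\<^sub>C y = a *\<^sub>C (x * y)"

class complex_algebra_1 = complex_algebra + monoid_mult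

instantiation complex :: complex_vector
begin
definition scaleC_complex :: "complex \<Rightarrow> complex \<Rightarrow> complex"
  where "scaleC_complex a x = a * x"
instance
  by standard (simp_all add: scaleC_complex_def algebra_simps)
end

definition is_subalgebra :: "'a::complex_algebra set \<Rightarrow> bool"
  where "is_subalgebra S \<longleftrightarrow> cvec.subspace S \<and> (\<forall>x\<in>S. \<forall>y\<in>S. x * y \<in> S)"

section \<open>The opposite algebra\<close>

typedef 'a opp = "UNIV :: 'a set"
  morphisms unopp opp
  by simp

setup_lifting type_definition_opp

instantiation opp :: (complex_vector) complex_vector
begin
lift_definition zero_opp :: "'a opp" is 0 .
lift_definition plus_opp :: "'a opp \<Rightarrow> 'a opp \<Rightarrow> 'a opp" is "(+)" .
lift_definition minus_opp :: "'a opp \<Rightarrow> 'a opp \<Rightarrow> 'a opp" is "(-)" .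
lift_definition uminus_opp :: "'a opp \<Rightarrow> 'a opp" is uminus .
lift_definition scaleC_opp :: "complex \<Rightarrow> 'a opp \<Rightarrow> 'a opp" is scaleC .
instance
  by standard (transfer; simp add: algebra_simps)+
end

instantiation opp :: (complex_algebra) complex_algebra
begin
lift_definition times_opp :: "'a opp \<Rightarrow> 'a opp \<Rightarrow> 'a opp" is "\<lambda>a b. b * a" .
instance
  by standard (transfer; simp add: algebra_simps mult_scaleC_left mult_scaleC_right)+
end

instantiation opp :: (complex_algebra_1) complex_algebra_1
begin
lift_definition one_opp :: "'a opp" is 1 .
instance
  by standard (transfer; simp)+
end

section \<open>The algebraic tensor product\<close>

text \<open>The free complex vector space on \<open>A \<times> B\<close> is modelled as \<open>(A \<times> B) \<Rightarrow>\<^sub>0 complex\<close>.\<close>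

instantiation poly_mapping :: (type, complex_vector) complex_vector
begin
definition scaleC_poly_mapping :: "complex \<Rightarrow> ('a \<Rightarrow>\<^sub>0 'b) \<Rightarrow> 'a \<Rightarrow>\<^sub>0 'b"
  where "scaleC_poly_mapping c p = Poly_Mapping.map (scaleC c) p"

lemma lookup_scaleC:
  "Poly_Mapping.lookup (c *\<^sub>C p) x = c *\<^sub>C Poly_Mapping.lookup p x"
  for p :: "'a \<Rightarrow>\<^sub>0 'b"
  unfolding scaleC_poly_mapping_def by (simp add: Poly_Mapping.map.rep_eq when_def)

instance
  by standard (rule poly_mapping_eqI, simp add: lookup_scaleC lookup_add algebra_simps)+
end

abbreviation gen :: "'a \<Rightarrow> 'b \<Rightarrow> ('a \<times> 'b) \<Rightarrow>\<^sub>0 complex"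
  where "gen a b \<equiv> Poly_Mapping.single (a, b) 1"

inductive_set bilinear_relations ::
    "(('a::complex_vector \<times> 'b::complex_vector) \<Rightarrow>\<^sub>0 complex) set"
  where
    add_left: "gen (a + a') b - (gen a b + gen a' b) \<in> bilinear_relations"
  | add_right: "gen a (b + b') - (gen a b + gen a b') \<in> bilinear_relations"
  | scaleC_left: "gen (c *\<^sub>C a) b - c *\<^sub>C gen a b \<in> bilinear_relations"
  | scaleC_right: "gen a (c *\<^sub>C b) - c *\<^sub>C gen a b \<in> bilinear_relations"

definition tensor_rel :: "(('a::complex_vector \<times> 'b::complex_vector) \<Rightarrow>\<^sub>0 complex) \<Rightarrow>
    (('a \<times> 'b) \<Rightarrow>\<^sub>0 complex) \<Rightarrow> bool"
  where "tensor_rel p q \<longleftrightarrow> p - q \<in> cvec.span bilinear_relations"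

lemma tensor_rel_eqI: "p = q \<Longrightarrow> tensor_rel p q"
  by (simp add: tensor_rel_def cvec.span_zero)

quotient_type (overloaded) ('a, 'b) tensor =
  "('a::complex_vector \<times> 'b::complex_vector) \<Rightarrow>\<^sub>0 complex" / tensor_rel
proof (rule equivpI)
  show "reflp (tensor_rel :: (('a \<times> 'b) \<Rightarrow>\<^sub>0 complex) \<Rightarrow> _)"
    by (auto simp: reflp_def intro: tensor_rel_eqI)
  show "symp (tensor_rel :: (('a \<times> 'b) \<Rightarrow>\<^sub>0 complex) \<Rightarrow> _)"
    by (auto simp: symp_def tensor_rel_def dest: cvec.span_neg)
  show "transp (tensor_rel :: (('a \<times> 'b) \<Rightarrow>\<^sub>0 complex) \<Rightarrow> _)"
    by (auto simp: transp_def tensor_rel_def dest: cvec.span_add)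
qed

instantiation tensor :: (complex_vector, complex_vector) complex_vector
begin
lift_definition zero_tensor :: "('a, 'b) tensor" is 0 .
lift_definition plus_tensor :: "('a, 'b) tensor \<Rightarrow> ('a, 'b) tensor \<Rightarrow> ('a, 'b) tensor" is "(+)"
  unfolding tensor_rel_def by (simp only: add_diff_add cvec.span_add)
lift_definition minus_tensor :: "('a, 'b) tensor \<Rightarrow> ('a, 'b) tensor \<Rightarrow> ('a, 'b) tensor" is "(-)"
proof -
  fix p p' q q' :: "('a \<times> 'b) \<Rightarrow>\<^sub>0 complex"
  assume "tensor_rel p p'" "tensor_rel q q'"
  then have "(p - p') - (q - q') \<in> cvec.span bilinear_relations"
    unfolding tensor_rel_def by (rule cvec.span_diff)
  moreover have "(p - p') - (q - q') = (p - q) - (p' - q')"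
    by (simp add: algebra_simps)
  ultimately show "tensor_rel (p - q) (p' - q')"
    unfolding tensor_rel_def by simp
qed
lift_definition uminus_tensor :: "('a, 'b) tensor \<Rightarrow> ('a, 'b) tensor" is uminus
proof -
  fix p p' :: "('a \<times> 'b) \<Rightarrow>\<^sub>0 complex"
  assume "tensor_rel p p'"
  then have "- (p - p') \<in> cvec.span bilinear_relations"
    unfolding tensor_rel_def by (rule cvec.span_neg)
  moreover have "- (p - p') = - p - - p'"
    by simp
  ultimately show "tensor_rel (- p) (- p')"
    unfolding tensor_rel_def by simp
qed
lift_definition scaleC_tensor :: "complex \<Rightarrow> ('a, 'b) tensor \<Rightarrow> ('a, 'b) tensor" is scaleC
  unfolding tensor_rel_def by (simp only: cvec.scale_right_diff_distrib[symmetric] cvec.span_scale)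
instance
  by standard (transfer, rule tensor_rel_eqI, simp add: algebra_simps)+
end

lift_definition pure_tensor :: "'a::complex_vector \<Rightarrow> 'b::complex_vector \<Rightarrow> ('a, 'b) tensor"
    (infixr "\<otimes>" 72)
  is gen .

lemma tensor_relI: "p - q \<in> bilinear_relations \<Longrightarrow> tensor_rel p q"
  unfolding tensor_rel_def by (rule cvec.span_base)

lemma tensor_add_left: "(a + a') \<otimes> b = a \<otimes> b + a' \<otimes> b"
  by transfer (rule tensor_relI, rule bilinear_relations.intros)

lemma tensor_add_right: "a \<otimes> (b + b') = a \<otimes> b + a \<otimes> b'"
  by transfer (rule tensor_relI, rule bilinear_relations.intros)

lemma tensor_scaleC_left: "(c *\<^sub>C a) \<otimes> b = c *\<^sub>C (a \<otimes> b)"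
  by transfer (rule tensor_relI, rule bilinear_relations.intros)

lemma tensor_scaleC_right: "a \<otimes> (c *\<^sub>C b) = c *\<^sub>C (a \<otimes> b)"
  by transfer (rule tensor_relI, rule bilinear_relations.intros)

definition cbilinear ::
    "('a::complex_vector \<Rightarrow> 'b::complex_vector \<Rightarrow> 'c::complex_vector) \<Rightarrow> bool"
  where "cbilinear f \<longleftrightarrow> (\<forall>b. clinear (\<lambda>a. f a b)) \<and> (\<forall>a. clinear (f a))"

definition free_ext :: "('k \<Rightarrow> 'v::complex_vector) \<Rightarrow> ('k \<Rightarrow>\<^sub>0 complex) \<Rightarrow> 'v"
  where "free_ext f p = (\<Sum>x\<in>Poly_Mapping.keys p. Poly_Mapping.lookup p x *\<^sub>C f x)"

text \<open>
  The linear map on the tensor product induced by \<open>f\<close>; for bilinear \<open>f\<close> it does not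
  depend on the representative chosen by \<open>rep_tensor\<close>, see \<open>tensor_ext_pure\<close> and
  \<open>clinear_tensor_ext\<close> below.
\<close>

definition tensor_ext :: "('a::complex_vector \<Rightarrow> 'b::complex_vector \<Rightarrow> 'v::complex_vector) \<Rightarrow>
    ('a, 'b) tensor \<Rightarrow> 'v"
  where "tensor_ext f t = free_ext (\<lambda>(a, b). f a b) (rep_tensor t)"

lemma free_ext_superset:
  assumes "finite K" "Poly_Mapping.keys p \<subseteq> K"
  shows "free_ext f p = (\<Sum>x\<in>K. Poly_Mapping.lookup p x *\<^sub>C f x)"
  unfolding free_ext_def
  by (rule sum.mono_neutral_left) (use assms in \<open>auto simp: in_keys_iff\<close>)

lemma free_ext_single: "free_ext f (Poly_Mapping.single x c) = c *\<^sub>C f x"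
  by (simp add: free_ext_superset[of "{x}"])

lemma clinear_free_ext: "clinear (free_ext f)"
proof -
  have "free_ext f (p + q) = free_ext f p + free_ext f q" for p q
  proof -
    let ?K = "Poly_Mapping.keys p \<union> Poly_Mapping.keys q"
    have "free_ext f (p + q) = (\<Sum>x\<in>?K. Poly_Mapping.lookup (p + q) x *\<^sub>C f x)"
      by (rule free_ext_superset) (auto simp: keys_add)
    also have "\<dots> = (\<Sum>x\<in>?K. Poly_Mapping.lookup p x *\<^sub>C f x)
        + (\<Sum>x\<in>?K. Poly_Mapping.lookup q x *\<^sub>C f x)"
      by (simp add: lookup_add scaleC_add_left sum.distrib)
    also have "\<dots> = free_ext f p + free_ext f q"
      by (simp add: free_ext_superset[of ?K])
    finally show ?thesis .
  qed
  moreover have "free_ext f (c *\<^sub>C p) = c *\<^sub>C free_ext f p" for c p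
  proof -
    have "free_ext f (c *\<^sub>C p)
        = (\<Sum>x\<in>Poly_Mapping.keys p. Poly_Mapping.lookup (c *\<^sub>C p) x *\<^sub>C f x)"
      by (rule free_ext_superset) (auto simp: in_keys_iff lookup_scaleC)
    also have "\<dots> = c *\<^sub>C free_ext f p"
      by (simp add: free_ext_def lookup_scaleC scaleC_complex_def cvec.scale_sum_right
          scaleC_scaleC)
    finally show ?thesis .
  qed
  ultimately show ?thesis
    by (simp add: clinear_iff)
qed

lemma free_ext_add_fun: "free_ext (\<lambda>x. f x + g x) p = free_ext f p + free_ext g p"
  by (simp add: free_ext_def scaleC_add_right sum.distrib)

lemma free_ext_scaleC_fun: "free_ext (\<lambda>x. c *\<^sub>C f x) p = c *\<^sub>C free_ext f p"
  by (simp add: free_ext_def cvec.scale_sum_right cvec.scale_left_commute del: cvec.scale_scale)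

lemma free_ext_relations:
  assumes f: "cbilinear f" and p: "p \<in> cvec.span bilinear_relations"
  shows "free_ext (\<lambda>(a, b). f a b) p = 0"
proof -
  let ?F = "free_ext (\<lambda>(a, b). f a b)"
  interpret F: Vector_Spaces.linear scaleC scaleC ?F
    by (rule clinear_free_ext)
  have f_bilinear: "f (a + a') b = f a b + f a' b" "f (c *\<^sub>C a) b = c *\<^sub>C f a b"
    "f a (b + b') = f a b + f a b'" "f a (c *\<^sub>C b) = c *\<^sub>C f a b" for a a' b b' c
    using f unfolding cbilinear_def clinear_iff by blast+
  have "?F q = 0" if "q \<in> bilinear_relations" for q
    using that
    by cases (simp_all add: f_bilinear F.diff F.add F.scale free_ext_single scaleC_one)
  with p show ?thesis
    by (induction rule: cvec.span_induct_alt) (simp_all add: F.add F.scale F.zero)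
qed

lemma tensor_ext_abs:
  assumes "cbilinear f"
  shows "tensor_ext f (abs_tensor p) = free_ext (\<lambda>(a, b). f a b) p"
proof -
  interpret F: Vector_Spaces.linear scaleC scaleC "free_ext (\<lambda>(a, b). f a b)"
    by (rule clinear_free_ext)
  have "tensor_rel (rep_tensor (abs_tensor p)) p"
    by (metis Quotient3_tensor Quotient3_rep_abs Quotient3_rel tensor_equivp equivp_reflp)
  then show ?thesis
    using free_ext_relations[OF assms] unfolding tensor_rel_def tensor_ext_def
    by (metis F.diff eq_iff_diff_eq_0)
qed

lemma tensor_ext_pure: "cbilinear f \<Longrightarrow> tensor_ext f (a \<otimes> b) = f a b"
  by (simp add: pure_tensor.abs_eq tensor_ext_abs free_ext_single scaleC_one)

lemma clinear_tensor_ext: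
  assumes "cbilinear f"
  shows "clinear (tensor_ext f)"
proof -
  interpret F: Vector_Spaces.linear scaleC scaleC "free_ext (\<lambda>(a, b). f a b)"
    by (rule clinear_free_ext)
  have "tensor_ext f (s + t) = tensor_ext f s + tensor_ext f t" for s t
    by (induction s rule: tensor.abs_induct; induction t rule: tensor.abs_induct)
      (simp add: plus_tensor.abs_eq tensor_ext_abs[OF assms] F.add)
  moreover have "tensor_ext f (c *\<^sub>C t) = c *\<^sub>C tensor_ext f t" for c t
    by (induction t rule: tensor.abs_induct)
      (simp add: scaleC_tensor.abs_eq tensor_ext_abs[OF assms] F.scale)
  ultimately show ?thesis
    by (simp add: clinear_iff)
qed

lemma tensor_ext_add_fun:
  "tensor_ext (\<lambda>a b. f a b + g a b) t = tensor_ext f t + tensor_ext g t"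
  by (simp add: tensor_ext_def free_ext_add_fun[symmetric] case_prod_unfold)

lemma tensor_ext_scaleC_fun: "tensor_ext (\<lambda>a b. c *\<^sub>C f a b) t = c *\<^sub>C tensor_ext f t"
  by (simp add: tensor_ext_def free_ext_scaleC_fun[symmetric] case_prod_unfold)

lemma tensor_induct [case_names pure add]:
  fixes t :: "('a::complex_vector, 'b::complex_vector) tensor"
  assumes pure: "\<And>a b. P (a \<otimes> b)" and add: "\<And>s t. P s \<Longrightarrow> P t \<Longrightarrow> P (s + t)"
  shows "P t"
proof -
  have zero: "P 0"
    using pure[of 0 0] tensor_scaleC_left[of 0 "0 :: 'a" "0 :: 'b"] by simp
  have scaled: "P (c *\<^sub>C (a \<otimes> b))" for a b c
    using pure[of "c *\<^sub>C a" b] by (simp add: tensor_scaleC_left)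
  have single: "P (abs_tensor (Poly_Mapping.single x c))" for x c
  proof -
    obtain a b where x: "x = (a, b)" by fastforce
    have "Poly_Mapping.single x c = c *\<^sub>C gen a b"
      by (rule poly_mapping_eqI)
        (simp add: x lookup_scaleC lookup_single scaleC_complex_def when_def)
    then show ?thesis
      using scaled[of c a b] by (simp add: pure_tensor.abs_eq scaleC_tensor.abs_eq)
  qed
  have "P (abs_tensor p)" for p
  proof (induction p rule: update_induct)
    case const
    then show ?case
      using zero by (simp add: zero_tensor.abs_eq)
  next
    case (update p k v)
    then have "Poly_Mapping.update k v p = p + Poly_Mapping.single k v"
      by (intro poly_mapping_eqI)
        (auto simp: lookup_update lookup_add lookup_single in_keys_iff when_def)
    then show ?case
      using add[OF update.IH single[of k v]] by (simp add: plus_tensor.abs_eq)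
  qed
  then show ?thesis
    by (induction t rule: tensor.abs_induct)
qed

instantiation tensor :: (complex_algebra, complex_algebra) complex_algebra
begin

text \<open>
  This is the product with \<open>(a \<otimes> b) * (a' \<otimes> b') = (a * a') \<otimes> (b * b')\<close>,
  see \<open>tensor_mult_pure\<close>.
\<close>

definition times_tensor :: "('a, 'b) tensor \<Rightarrow> ('a, 'b) tensor \<Rightarrow> ('a, 'b) tensor"
  where "s * t = tensor_ext (\<lambda>a b. tensor_ext (\<lambda>a' b'. (a * a') \<otimes> (b * b')) t) s"

lemma cbilinear_mult_pure:
  fixes a :: 'a and b :: 'b
  shows "cbilinear (\<lambda>a' b'. (a * a') \<otimes> (b * b'))"
  by (simp add: cbilinear_def clinear_iff distrib_left mult_scaleC_right tensor_add_left
      tensor_add_right tensor_scaleC_left tensor_scaleC_right)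

lemma cbilinear_mult:
  fixes t :: "('a, 'b) tensor"
  shows "cbilinear (\<lambda>a b. tensor_ext (\<lambda>a' b'. (a * a') \<otimes> (b * b')) t)"
  by (simp add: cbilinear_def clinear_iff distrib_right mult_scaleC_left tensor_add_left
      tensor_add_right tensor_scaleC_left tensor_scaleC_right tensor_ext_add_fun
      tensor_ext_scaleC_fun)

lemma tensor_mult_pure: "(a \<otimes> b) * (a' \<otimes> b') = (a * a') \<otimes> (b * b')"
  for a a' :: 'a and b b' :: 'b
  unfolding times_tensor_def
  by (subst tensor_ext_pure[OF cbilinear_mult], rule tensor_ext_pure[OF cbilinear_mult_pure])

instance
proof
  fix s t u :: "('a, 'b) tensor" and c :: complex
  show left: "(s + t) * u = s * u + t * u" for s t u :: "('a, 'b) tensor"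
    using clinear_tensor_ext[OF cbilinear_mult[of u]] by (simp add: times_tensor_def clinear_iff)
  show right: "s * (t + u) = s * t + s * u" for s t u :: "('a, 'b) tensor"
    using clinear_tensor_ext[OF cbilinear_mult_pure]
    by (simp add: times_tensor_def clinear_iff tensor_ext_add_fun)
  show "(c *\<^sub>C s) * t = c *\<^sub>C (s * t)"
    using clinear_tensor_ext[OF cbilinear_mult[of t]] by (simp add: times_tensor_def clinear_iff)
  show "s * (c *\<^sub>C t) = c *\<^sub>C (s * t)"
    using clinear_tensor_ext[OF cbilinear_mult_pure]
    by (simp add: times_tensor_def clinear_iff tensor_ext_scaleC_fun)
  show "s * t * u = s * (t * u)"
  proof (induction s rule: tensor_induct)
    case s: (pure a b)
    show ?case
    proof (induction t rule: tensor_induct)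
      case t: (pure a' b')
      show ?case
        by (induction u rule: tensor_induct)
          (simp_all add: tensor_mult_pure mult.assoc right)
    qed (simp add: left right)
  qed (simp add: left)
qed

end

instantiation tensor :: (complex_algebra_1, complex_algebra_1) complex_algebra_1
begin
definition one_tensor :: "('a, 'b) tensor"
  where "one_tensor = 1 \<otimes> 1"
instance
proof
  fix t :: "('a, 'b) tensor"
  show "1 * t = t"
    by (induction t rule: tensor_induct)
      (simp_all add: one_tensor_def tensor_mult_pure distrib_left)
  show "t * 1 = t"
    by (induction t rule: tensor_induct)
      (simp_all add: one_tensor_def tensor_mult_pure distrib_right)
qed
end

section \<open>The algebras \<open>T_Lie\<close> and \<open>N_Lie\<close>\<close>

definition T_Lie :: "'b::complex_algebra_1 itself \<Rightarrow> ('b, 'b opp) tensor set"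
  where "T_Lie _ = is_subalgebra hull {a \<otimes> 1 - 1 \<otimes> opp a | a. True}"

definition N_Lie :: "'b::complex_algebra_1 itself \<Rightarrow> ('b, 'b opp) tensor set"
  where "N_Lie _ = {\<Sum>k<n. a k \<otimes> opp (b k) | (n::nat) a b.
    (\<Sum>k<n. a k * b k) = 0 \<and> (\<Sum>k<n. b k * a k) = 0}"

section \<open>Linear operators and the unitization of the finite-rank operators\<close>

typedef (overloaded) 'a linop = "{f :: 'a::complex_vector \<Rightarrow> 'a. clinear f}"
  morphisms app Linop
  by (rule exI[of _ "\<lambda>x. x"]) (simp add: clinear_iff)

setup_lifting type_definition_linop

instantiation linop :: (complex_vector) complex_algebra_1
begin
lift_definition zero_linop :: "'a linop" is "\<lambda>x. 0"
  by (simp add: clinear_iff)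
lift_definition one_linop :: "'a linop" is "\<lambda>x. x"
  by (simp add: clinear_iff)
lift_definition plus_linop :: "'a linop \<Rightarrow> 'a linop \<Rightarrow> 'a linop" is "\<lambda>f g x. f x + g x"
  by (simp add: clinear_iff scaleC_add_right algebra_simps)
lift_definition minus_linop :: "'a linop \<Rightarrow> 'a linop \<Rightarrow> 'a linop" is "\<lambda>f g x. f x - g x"
  by (simp add: clinear_iff cvec.scale_right_diff_distrib algebra_simps)
lift_definition uminus_linop :: "'a linop \<Rightarrow> 'a linop" is "\<lambda>f x. - f x"
  by (simp add: clinear_iff)
lift_definition times_linop :: "'a linop \<Rightarrow> 'a linop \<Rightarrow> 'a linop" is "\<lambda>f g x. f (g x)"
  by (simp add: clinear_iff)
lift_definition scaleC_linop :: "complex \<Rightarrow> 'a linop \<Rightarrow> 'a linop" is "\<lambda>c f x. c *\<^sub>C f x"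
  by (simp add: clinear_iff scaleC_add_right mult.commute)
instance
  by standard (transfer; simp add: clinear_iff fun_eq_iff scaleC_add_left scaleC_add_right)+
end

definition finite_rank :: "'a::complex_vector linop set"
  where "finite_rank = {T. \<exists>S. finite S \<and> range (app T) \<subseteq> cvec.span S}"

lemma finite_rank_zero: "0 \<in> finite_rank"
  by (auto simp: finite_rank_def zero_linop.rep_eq cvec.span_zero intro!: exI[of _ "{}"])

lemma finite_rank_add:
  assumes "T \<in> finite_rank" "U \<in> finite_rank"
  shows "T + U \<in> finite_rank"
proof -
  obtain S S' where "finite S" "range (app T) \<subseteq> cvec.span S"
    and "finite S'" "range (app U) \<subseteq> cvec.span S'"
    using assms unfolding finite_rank_def by auto
  then have "finite (S \<union> S') \<and> range (app (T + U)) \<subseteq> cvec.span (S \<union> S')"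
    using cvec.span_mono[of S "S \<union> S'"] cvec.span_mono[of S' "S \<union> S'"]
    by (auto simp: plus_linop.rep_eq intro!: cvec.span_add)
  then show ?thesis
    unfolding finite_rank_def by blast
qed

lemma finite_rank_mult_right: "T \<in> finite_rank \<Longrightarrow> T * U \<in> finite_rank"
  unfolding finite_rank_def by (auto simp: times_linop.rep_eq)

lemma finite_rank_mult_left:
  assumes "T \<in> finite_rank"
  shows "U * T \<in> finite_rank"
proof -
  interpret U: Vector_Spaces.linear scaleC scaleC "app U"
    using app[of U] by simp
  obtain S where "finite S" "range (app T) \<subseteq> cvec.span S"
    using assms unfolding finite_rank_def by auto
  then have "finite (app U ` S) \<and> range (app (U * T)) \<subseteq> cvec.span (app U ` S)"
    by (auto simp: times_linop.rep_eq U.span_image)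
  then show ?thesis
    unfolding finite_rank_def by blast
qed

lemma finite_rank_scaleC: "T \<in> finite_rank \<Longrightarrow> c *\<^sub>C T \<in> finite_rank"
  using finite_rank_mult_left[of T "c *\<^sub>C 1"] by (simp add: mult_scaleC_left)

definition finrank_unital_set :: "'a::complex_vector linop set"
  where "finrank_unital_set = {T + c *\<^sub>C 1 | T c. T \<in> finite_rank}"

lemma finrank_unital_zero: "0 \<in> finrank_unital_set"
  unfolding finrank_unital_set_def using finite_rank_zero by force

lemma finrank_unital_one: "(1 :: 'a::complex_vector linop) \<in> finrank_unital_set"
proof -
  have "1 = 0 + 1 *\<^sub>C (1 :: 'a linop)"
    by (simp add: scaleC_one)
  then show ?thesis
    unfolding finrank_unital_set_def using finite_rank_zero by blast
qed

lemma finrank_unital_add: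
  assumes "A \<in> finrank_unital_set" "B \<in> finrank_unital_set"
  shows "A + B \<in> finrank_unital_set"
proof -
  obtain T c U d where "A = T + c *\<^sub>C 1" "B = U + d *\<^sub>C 1" "T \<in> finite_rank" "U \<in> finite_rank"
    using assms unfolding finrank_unital_set_def by blast
  then have "A + B = (T + U) + (c + d) *\<^sub>C 1" "T + U \<in> finite_rank"
    by (simp_all add: scaleC_add_left finite_rank_add algebra_simps)
  then show ?thesis
    unfolding finrank_unital_set_def by blast
qed

lemma finrank_unital_mult:
  assumes "A \<in> finrank_unital_set" "B \<in> finrank_unital_set"
  shows "A * B \<in> finrank_unital_set"
proof -
  obtain T c U d where "A = T + c *\<^sub>C 1" "B = U + d *\<^sub>C 1" "T \<in> finite_rank" "U \<in> finite_rank"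
    using assms unfolding finrank_unital_set_def by blast
  then have "A * B = (T * B + c *\<^sub>C U) + (c * d) *\<^sub>C 1" "T * B + c *\<^sub>C U \<in> finite_rank"
    by (simp_all add: finite_rank_add finite_rank_mult_right finite_rank_scaleC
        mult_scaleC_left mult_scaleC_right scaleC_add_right algebra_simps)
  then show ?thesis
    unfolding finrank_unital_set_def by blast
qed

lemma finrank_unital_scaleC: "A \<in> finrank_unital_set \<Longrightarrow> c *\<^sub>C A \<in> finrank_unital_set"
proof -
  have "c *\<^sub>C 1 \<in> (finrank_unital_set :: 'a linop set)"
    unfolding finrank_unital_set_def using finite_rank_zero by force
  then show "A \<in> finrank_unital_set \<Longrightarrow> c *\<^sub>C A \<in> finrank_unital_set"
    using finrank_unital_mult[of "c *\<^sub>C 1" A] by (simp add: mult_scaleC_left)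
qed

lemma finrank_unital_uminus: "A \<in> finrank_unital_set \<Longrightarrow> - A \<in> finrank_unital_set"
  using finrank_unital_scaleC[of A "-1"] by simp

lemma finrank_unital_diff:
  "A \<in> finrank_unital_set \<Longrightarrow> B \<in> finrank_unital_set \<Longrightarrow> A - B \<in> finrank_unital_set"
  using finrank_unital_add[of A "- B"] finrank_unital_uminus[of B] by simp

typedef (overloaded) 'a finrank_unital = "finrank_unital_set :: 'a::complex_vector linop set"
  using finrank_unital_zero by blast

setup_lifting type_definition_finrank_unital

instantiation finrank_unital :: (complex_vector) complex_algebra_1
begin
lift_definition zero_finrank_unital :: "'a finrank_unital" is 0
  by (rule finrank_unital_zero)
lift_definition one_finrank_unital :: "'a finrank_unital" is 1
  by (rule finrank_unital_one)
lift_definition plus_finrank_unital ::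
    "'a finrank_unital \<Rightarrow> 'a finrank_unital \<Rightarrow> 'a finrank_unital" is "(+)"
  by (rule finrank_unital_add)
lift_definition minus_finrank_unital ::
    "'a finrank_unital \<Rightarrow> 'a finrank_unital \<Rightarrow> 'a finrank_unital" is "(-)"
  by (rule finrank_unital_diff)
lift_definition uminus_finrank_unital :: "'a finrank_unital \<Rightarrow> 'a finrank_unital" is uminus
  by (rule finrank_unital_uminus)
lift_definition times_finrank_unital ::
    "'a finrank_unital \<Rightarrow> 'a finrank_unital \<Rightarrow> 'a finrank_unital" is "(*)"
  by (rule finrank_unital_mult)
lift_definition scaleC_finrank_unital ::
    "complex \<Rightarrow> 'a finrank_unital \<Rightarrow> 'a finrank_unital" is scaleC
  by (rule finrank_unital_scaleC)
instance
  by standard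
    (transfer; simp add: algebra_simps scaleC_add_left scaleC_add_right mult_scaleC_left
      mult_scaleC_right)+
end

end

theory Submission
  imports Defs
begin

text \<open>
  Let \<open>B\<close> act on itself by two-sided multiplication. Finitely many finite-rank operators lie in
  the span of a finite system of matrix units \<open>E i j\<close> with sum \<open>e = \<Sum>i. E i i\<close>. The elements
  \<open>delta e\<close> and its square generate the projections onto \<open>e B (1 - e)\<close> and \<open>(1 - e) B e\<close>, and
  multiplying by these reduces a tensor of \<open>N_Lie\<close> to one over the matrix algebra \<open>e B e\<close>.
  There \<open>N_Lie\<close> becomes the algebra of operators that kill the identity and have traceless values,
  a tensor product of the traceless matrices with their dual. Starting from \<open>E i j \<otimes> E i j\<close> with
  \<open>i \<noteq> j\<close>, which is the square of \<open>delta (E i j)\<close> up to a factor, multiplication by commutators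
  from both sides reaches a spanning set of this space.
\<close>

section \<open>Elementary tensors over the opposite algebra\<close>

definition tens :: "'b::complex_algebra_1 \<Rightarrow> 'b \<Rightarrow> ('b, 'b opp) tensor"
  where "tens a b = a \<otimes> opp b"

lemma tens_add_left: "tens (a + a') b = tens a b + tens a' b"
  by (simp add: tens_def tensor_add_left)

lemma tens_add_right: "tens a (b + b') = tens a b + tens a b'"
  by (simp add: tens_def tensor_add_right flip: plus_opp.abs_eq)

lemma tens_scaleC_left: "tens (c *\<^sub>C a) b = c *\<^sub>C tens a b"
  by (simp add: tens_def tensor_scaleC_left)

lemma tens_scaleC_right: "tens a (c *\<^sub>C b) = c *\<^sub>C tens a b"
  by (simp add: tens_def tensor_scaleC_right flip: scaleC_opp.abs_eq)

lemma tens_zero_left [simp]: "tens 0 b = 0"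
  using tens_scaleC_left[of 0 0 b] by simp

lemma tens_zero_right [simp]: "tens a 0 = 0"
  using tens_scaleC_right[of a 0 0] by simp

lemma tens_diff_left: "tens (a - a') b = tens a b - tens a' b"
  using tens_add_left[of "a - a'" a' b] by (simp add: algebra_simps)

lemma tens_diff_right: "tens a (b - b') = tens a b - tens a b'"
  using tens_add_right[of a "b - b'" b'] by (simp add: algebra_simps)

lemma tens_sum_left: "tens (\<Sum>i\<in>I. f i) b = (\<Sum>i\<in>I. tens (f i) b)"
  by (induction I rule: infinite_finite_induct) (simp_all add: tens_add_left)

lemma tens_sum_right: "tens a (\<Sum>i\<in>I. f i) = (\<Sum>i\<in>I. tens a (f i))"
  by (induction I rule: infinite_finite_induct) (simp_all add: tens_add_right)

lemma tens_mult: "tens a b * tens a' b' = tens (a * a') (b' * b)"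
  by (simp add: tens_def tensor_mult_pure times_opp.abs_eq)

lemma tens_induct [case_names tens add]:
  assumes "\<And>a b. P (tens a b)" and "\<And>s t. P s \<Longrightarrow> P t \<Longrightarrow> P (s + t)"
  shows "P t"
proof (induction t rule: tensor_induct)
  case (pure a b)
  then show ?case
    using assms(1)[of a "unopp b"] by (simp add: tens_def unopp_inverse)
qed (rule assms(2))

section \<open>The two multiplication maps and their common kernel\<close>

definition mu :: "('b::complex_algebra_1, 'b opp) tensor \<Rightarrow> 'b"
  where "mu = tensor_ext (\<lambda>a b. a * unopp b)"

definition mu_op :: "('b::complex_algebra_1, 'b opp) tensor \<Rightarrow> 'b"
  where "mu_op = tensor_ext (\<lambda>a b. unopp b * a)"

lemma cbilinear_mu: "cbilinear (\<lambda>a b. a * unopp b :: 'b::complex_algebra_1)"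
  by (simp add: cbilinear_def clinear_iff algebra_simps mult_scaleC_left mult_scaleC_right
      plus_opp.rep_eq scaleC_opp.rep_eq)

lemma cbilinear_mu_op: "cbilinear (\<lambda>a b. unopp b * a :: 'b::complex_algebra_1)"
  by (simp add: cbilinear_def clinear_iff algebra_simps mult_scaleC_left mult_scaleC_right
      plus_opp.rep_eq scaleC_opp.rep_eq)

lemma mu_linear:
  fixes a b :: "'b::complex_algebra_1" and s t :: "('b, 'b opp) tensor"
  shows mu_tens: "mu (tens a b) = a * b"
    and mu_add: "mu (s + t) = mu s + mu t"
    and mu_scaleC: "mu (c *\<^sub>C s) = c *\<^sub>C mu s"
  using clinear_tensor_ext[OF cbilinear_mu[where 'b = 'b]]
  by (simp_all add: mu_def tens_def tensor_ext_pure[OF cbilinear_mu] opp_inverse clinear_iff)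

lemma mu_op_linear:
  fixes a b :: "'b::complex_algebra_1" and s t :: "('b, 'b opp) tensor"
  shows mu_op_tens: "mu_op (tens a b) = b * a"
    and mu_op_add: "mu_op (s + t) = mu_op s + mu_op t"
    and mu_op_scaleC: "mu_op (c *\<^sub>C s) = c *\<^sub>C mu_op s"
  using clinear_tensor_ext[OF cbilinear_mu_op[where 'b = 'b]]
  by (simp_all add: mu_op_def tens_def tensor_ext_pure[OF cbilinear_mu_op] opp_inverse clinear_iff)

lemma mu_zero: "mu 0 = 0" and mu_op_zero: "mu_op 0 = 0"
  using mu_scaleC[of 0 0] mu_op_scaleC[of 0 0] by simp_all

lemma mu_sum: "mu (\<Sum>i\<in>I. f i) = (\<Sum>i\<in>I. mu (f i))"
  by (induction I rule: infinite_finite_induct) (simp_all add: mu_zero mu_add)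

lemma mu_op_sum: "mu_op (\<Sum>i\<in>I. f i) = (\<Sum>i\<in>I. mu_op (f i))"
  by (induction I rule: infinite_finite_induct) (simp_all add: mu_op_zero mu_op_add)

lemma mu_tens_mult: "mu (tens a b * t) = a * mu t * b"
  by (induction t rule: tens_induct) (simp_all add: tens_mult mu_tens mu_add algebra_simps)

text \<open>Read \<open>tens a b\<close> as the map x to a x b. Then \<open>mu\<close> is evaluation
  at 1, so its kernel is a left ideal. Dually, \<open>mu_op_mult_eq_0\<close> makes the kernel of
  \<open>mu_op\<close> a right ideal.\<close>

lemma mu_mult_eq_0: "mu t = 0 \<Longrightarrow> mu (s * t) = 0"
  by (induction s rule: tens_induct) (simp_all add: mu_tens_mult mu_add algebra_simps)

lemma mu_op_mult_tens: "mu_op (s * tens a b) = b * mu_op s * a"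
  by (induction s rule: tens_induct) (simp_all add: tens_mult mu_op_tens mu_op_add algebra_simps)

lemma mu_op_mult_eq_0: "mu_op s = 0 \<Longrightarrow> mu_op (s * t) = 0"
  by (induction t rule: tens_induct) (simp_all add: mu_op_mult_tens mu_op_add algebra_simps)

lemma tensor_finite_sum: "\<exists>(n::nat) a b. t = (\<Sum>k<n. tens (a k) (b k))"
proof (induction t rule: tens_induct)
  case (tens a b)
  show ?case
    by (rule exI[of _ "Suc 0"], rule exI[of _ "\<lambda>_. a"], rule exI[of _ "\<lambda>_. b"]) simp
next
  case (add s t)
  then obtain n m :: nat and a b a' b' where
    s: "s = (\<Sum>k<n. tens (a k) (b k))" and t: "t = (\<Sum>k<m. tens (a' k) (b' k))"
    by blast
  let ?A = "\<lambda>k. if k < n then a k else a' (k - n)"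
  let ?B = "\<lambda>k. if k < n then b k else b' (k - n)"
  have "s + t = (\<Sum>k<n + m. tens (?A k) (?B k))"
    unfolding s t by (induction m) (simp_all flip: add.assoc)
  then show ?case
    by (intro exI)
qed

text \<open>Both maps are linear on tensors, so the two sums in \<open>N_Lie\<close> do not depend
  on how a tensor is written as a sum.\<close>

lemma N_Lie_eq_kernel: "N_Lie TYPE('b::complex_algebra_1) = {t. mu t = 0 \<and> mu_op t = 0}"
proof (intro equalityI subsetI)
  fix t :: "('b, 'b opp) tensor"
  assume "t \<in> N_Lie TYPE('b)"
  then show "t \<in> {t. mu t = 0 \<and> mu_op t = 0}"
    by (auto simp: N_Lie_def mu_sum mu_op_sum mu_tens mu_op_tens simp flip: tens_def)
next
  fix t :: "('b, 'b opp) tensor"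
  assume t: "t \<in> {t. mu t = 0 \<and> mu_op t = 0}"
  obtain n :: nat and a b where "t = (\<Sum>k<n. tens (a k) (b k))"
    using tensor_finite_sum by blast
  moreover from this t have "(\<Sum>k<n. a k * b k) = 0" "(\<Sum>k<n. b k * a k) = 0"
    by (simp_all add: mu_sum mu_op_sum mu_tens mu_op_tens)
  ultimately show "t \<in> N_Lie TYPE('b)"
    unfolding N_Lie_def tens_def by blast
qed

section \<open>The inclusion of \<open>T_Lie\<close> in \<open>N_Lie\<close>\<close>

definition delta :: "'b::complex_algebra_1 \<Rightarrow> ('b, 'b opp) tensor"
  where "delta a = tens a 1 - tens 1 a"

text \<open>A left ideal and a right ideal meet in a subalgebra, and both maps send
  \<open>delta a\<close> to a - a = 0.\<close>

lemma T_Lie_subset_N_Lie: "T_Lie TYPE('b::complex_algebra_1) \<subseteq> N_Lie TYPE('b)"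
proof -
  have diff: "mu (s - t) = mu s - mu t" "mu_op (s - t) = mu_op s - mu_op t"
    for s t :: "('b, 'b opp) tensor"
    using mu_add[of "s - t" t] mu_op_add[of "s - t" t] by (simp_all add: algebra_simps)
  have "is_subalgebra (N_Lie TYPE('b))"
    by (auto simp: is_subalgebra_def cvec.subspace_def N_Lie_eq_kernel mu_zero mu_op_zero
        mu_add mu_op_add mu_scaleC mu_op_scaleC mu_mult_eq_0 mu_op_mult_eq_0)
  moreover have "delta a \<in> N_Lie TYPE('b)" for a :: 'b
    by (simp add: N_Lie_eq_kernel delta_def diff mu_tens mu_op_tens)
  ultimately show ?thesis
    unfolding T_Lie_def
    by (intro hull_minimal) (auto simp: delta_def tens_def simp flip: one_opp_def)
qed

section \<open>Matrix units\<close>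

context
  fixes T :: "('b::complex_algebra_1, 'b opp) tensor set"
  defines "T \<equiv> T_Lie TYPE('b)"
begin

section \<open>Closure properties of \<open>T\<close> and products of its generators\<close>

lemma is_subalgebra_T: "is_subalgebra T"
  unfolding T_def T_Lie_def
  by (rule hull_in) (auto simp: is_subalgebra_def intro: cvec.subspace_Inter)

lemma T_subspace: "cvec.subspace T"
  using is_subalgebra_T by (simp add: is_subalgebra_def)

lemmas T_add = cvec.subspace_add[OF T_subspace]
  and T_diff = cvec.subspace_diff[OF T_subspace]
  and T_neg = cvec.subspace_neg[OF T_subspace]
  and T_scaleC = cvec.subspace_scale[OF T_subspace]
  and T_sum = cvec.subspace_sum[OF T_subspace]
  and T_zero = cvec.subspace_0[OF T_subspace]

lemma T_mult: "s \<in> T \<Longrightarrow> t \<in> T \<Longrightarrow> s * t \<in> T"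
  using is_subalgebra_T by (simp add: is_subalgebra_def)

lemma T_delta: "delta a \<in> T"
  unfolding T_def T_Lie_def
  by (rule hull_inc) (auto simp: delta_def tens_def simp flip: one_opp_def)

lemma T_halve:
  assumes "t + t \<in> T"
  shows "t \<in> T"
proof -
  have "(1/2) *\<^sub>C (t + t) = t"
    by (simp add: scaleC_add_right flip: scaleC_add_left)
  then show ?thesis
    using T_scaleC[OF assms, of "1/2"] by simp
qed

lemma delta_mult_tens: "delta a * tens b c = tens (a * b) c - tens b (c * a)"
  by (simp add: delta_def left_diff_distrib tens_mult)

lemma tens_mult_delta: "tens b c * delta a = tens (b * a) c - tens b (a * c)"
  by (simp add: delta_def right_diff_distrib tens_mult)

lemma delta_mult_delta:
  "delta a * delta b = tens (a * b) 1 - tens a b - tens b a + tens 1 (b * a)"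
  by (simp add: delta_def algebra_simps tens_mult)

text \<open>In the square of \<open>delta a\<close> the two outer terms contain a squared and
  vanish, and the two mixed terms agree.\<close>

lemma T_square_zero:
  assumes "a * a = 0"
  shows "tens a a \<in> T"
proof -
  have "- (delta a * delta a) = tens a a + tens a a"
    by (simp add: delta_mult_delta assms)
  then show ?thesis
    by (metis T_halve T_neg T_mult T_delta)
qed

text \<open>
  On \<open>B\<close> split by the idempotent \<open>e\<close>, the square of \<open>delta e\<close> plus \<open>delta e\<close> is twice the
  projection onto \<open>e B (1 - e)\<close>.
\<close>

lemma T_tens_complement:
  assumes e: "e * e = e" and a: "e * a = a" "a * e = a"
  shows "tens a (1 - e) \<in> T" "tens (1 - e) a \<in> T"
proof -
  have "delta e * delta e + delta e = tens e (1 - e) + tens e (1 - e)"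
    "delta e * delta e - delta e = tens (1 - e) e + tens (1 - e) e"
    unfolding delta_mult_delta by (simp_all add: e tens_diff_right tens_diff_left delta_def)
  then have Q: "tens e (1 - e) \<in> T" "tens (1 - e) e \<in> T"
    by (metis T_halve T_add T_diff T_mult T_delta)+
  \<comment> \<open>Since e a = a and a (1 - e) = 0, only the first term of
    \<open>tens_mult_delta\<close> survives. Below it is the second one, hence the sign.\<close>
  have "tens e (1 - e) * delta a = tens a (1 - e)"
    by (simp add: tens_mult_delta a right_diff_distrib)
  then show "tens a (1 - e) \<in> T"
    using T_mult[OF Q(1) T_delta[of a]] by simp
  have "- (tens (1 - e) e * delta a) = tens (1 - e) a"
    by (simp add: tens_mult_delta a left_diff_distrib)
  then show "tens (1 - e) a \<in> T"
    using T_neg[OF T_mult[OF Q(2) T_delta[of a]]] by simp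
qed

section \<open>Tensors of matrix units that lie in \<open>T\<close>\<close>

context
  fixes n :: nat and E :: "nat \<Rightarrow> nat \<Rightarrow> 'b"
  assumes E_mult: "\<And>i j k l. i < n \<Longrightarrow> j < n \<Longrightarrow> k < n \<Longrightarrow> l < n \<Longrightarrow>
      E i j * E k l = (if j = k then E i l else 0)"
    and E_nonzero: "\<And>i j. i < n \<Longrightarrow> j < n \<Longrightarrow> E i j \<noteq> 0"
begin

text \<open>As an operator, \<open>M i l j k\<close> sends \<open>x\<close> to \<open>E i j * x * E k l = x\<^sub>j\<^sub>k E i l\<close>.\<close>

definition M :: "nat \<Rightarrow> nat \<Rightarrow> nat \<Rightarrow> nat \<Rightarrow> ('b, 'b opp) tensor"
  where "M i l j k = tens (E i j) (E k l)"

text \<open>Multiplication from the left acts on the values alone: \<open>E i l\<close> becomes its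
  commutator with \<open>E p q\<close>, and j, k stay. In \<open>M_mult_delta\<close> the functional
  changes instead, and i, l stay.\<close>

lemma delta_mult_M:
  assumes "p < n" "q < n" "i < n" "l < n" "j < n" "k < n"
  shows "delta (E p q) * M i l j k =
    (if q = i then M p l j k else 0) - (if l = p then M i q j k else 0)"
  using assms by (simp add: M_def delta_mult_tens E_mult)

lemma M_mult_delta:
  assumes "p < n" "q < n" "i < n" "l < n" "j < n" "k < n"
  shows "M i l j k * delta (E p q) =
    (if j = p then M i l q k else 0) - (if q = k then M i l j p else 0)"
  using assms by (simp add: M_def tens_mult_delta E_mult)

text \<open>Indices are changed one at a time without ever becoming equal. If the wanted first index
  is the present second one, the pair has to be swapped first; with only two indices the swap is the
  only move there is.\<close>

lemma off_diagonal_transport: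
  fixes P :: "nat \<Rightarrow> nat \<Rightarrow> bool"
  assumes row: "\<And>i l p. P i l \<Longrightarrow> i < n \<Longrightarrow> l < n \<Longrightarrow> p < n \<Longrightarrow> i \<noteq> l \<Longrightarrow> p \<noteq> l \<Longrightarrow> p \<noteq> i \<Longrightarrow> P p l"
    and col: "\<And>i l q. P i l \<Longrightarrow> i < n \<Longrightarrow> l < n \<Longrightarrow> q < n \<Longrightarrow> i \<noteq> l \<Longrightarrow> q \<noteq> i \<Longrightarrow> q \<noteq> l \<Longrightarrow> P i q"
    and swap: "\<And>i l. P i l \<Longrightarrow> i < n \<Longrightarrow> l < n \<Longrightarrow> i \<noteq> l \<Longrightarrow> P l i"
    and P: "P i l" and *: "i < n" "l < n" "i \<noteq> l" "p < n" "q < n" "p \<noteq> q"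
  shows "P p q"
proof (cases "p = l")
  case True
  then show ?thesis
    using col[of l i q] swap[OF P] * by (cases "q = i") auto
next
  case False
  then have "P p l"
    using row[OF P, of p] P * by (cases "p = i") auto
  then show ?thesis
    using col[of p l q] * False by (cases "q = l") auto
qed

text \<open>The commutator of \<open>E l i\<close> with \<open>E i l\<close> is
  \<open>E l l - E i i\<close>.\<close>

lemma M_left_diag:
  assumes "M i l j k \<in> T" "i < n" "l < n" "i \<noteq> l" "j < n" "k < n"
  shows "M l l j k - M i i j k \<in> T"
  using T_mult[OF T_delta[of "E l i"] assms(1)] assms by (simp add: delta_mult_M)

lemma M_right_diag:
  assumes "M i l j k \<in> T" "i < n" "l < n" "j < n" "k < n" "j \<noteq> k"
  shows "M i l k k - M i l j j \<in> T"
  using T_mult[OF assms(1) T_delta[of "E j k"]] assms by (simp add: M_mult_delta)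

text \<open>Multiplying twice by \<open>delta (E j k)\<close> gives -2 times the swapped tensor,
  just as ad(e) squared sends f to -2e in sl(2).\<close>

lemma M_right_swap:
  assumes "M i l j k \<in> T" "i < n" "l < n" "j < n" "k < n" "j \<noteq> k"
  shows "M i l k j \<in> T"
proof -
  have "(M i l k k - M i l j j) * delta (E j k) = - M i l k j - M i l k j"
    using assms by (simp add: left_diff_distrib M_mult_delta)
  then have "- M i l k j + - M i l k j \<in> T"
    using T_mult[OF M_right_diag[OF assms] T_delta[of "E j k"]] by simp
  then show ?thesis
    using T_neg[OF T_halve] by fastforce
qed

text \<open>Only the pair (j, k) has to be moved: each pair i \<noteq> l has its own starting
  tensor, both factors of which are the square-zero element \<open>E i l\<close>.\<close>

lemma M_off_diagonal:
  assumes "i < n" "l < n" "j < n" "k < n" "i \<noteq> l" "j \<noteq> k"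
  shows "M i l j k \<in> T"
proof -
  have base: "M i l l i \<in> T"
    using assms by (simp add: M_def T_square_zero E_mult)
  have row: "M i l p k \<in> T"
    if "M i l j k \<in> T" "j < n" "k < n" "p < n" "j \<noteq> k" "p \<noteq> k" "p \<noteq> j" for j k p
  proof -
    have "M i l j k * delta (E j p) = M i l p k"
      using assms that by (simp add: M_mult_delta)
    then show ?thesis
      using T_mult[OF that(1) T_delta[of "E j p"]] by simp
  qed
  have col: "M i l j q \<in> T"
    if "M i l j k \<in> T" "j < n" "k < n" "q < n" "j \<noteq> k" "q \<noteq> j" "q \<noteq> k" for j k q
  proof -
    have "M i l j k * delta (E q k) = - M i l j q"
      using assms that by (simp add: M_mult_delta)
    then show ?thesis
      using T_neg[OF T_mult[OF that(1) T_delta[of "E q k"]]] by simp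
  qed
  show ?thesis
  proof (rule off_diagonal_transport[where P = "\<lambda>j k. M i l j k \<in> T" and i = l and l = i])
    show "M i l k j \<in> T" if "M i l j k \<in> T" "j < n" "k < n" "j \<noteq> k" for j k
      using M_right_swap[of i l j k] assms that by simp
  qed (fact row, fact col, use base assms in simp_all)
qed

text \<open>
  The matrix \<open>E i l\<close> is made traceless by subtracting \<open>E 0 0\<close> when \<open>i = l\<close>, and likewise
  the functional \<open>x\<^sub>j\<^sub>k\<close> is made to vanish on the identity.
\<close>

lemma M_corrected:
  assumes "i < n" "l < n" "j < n" "k < n"
  shows "M i l j k - (if i = l then M 0 0 j k else 0) - (if j = k then M i l 0 0 else 0)
    + (if i = l \<and> j = k then M 0 0 0 0 else 0) \<in> T" (is "?C \<in> T")
proof -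
  have n: "0 < n"
    using assms by simp
  consider "i \<noteq> l" "j \<noteq> k" | "i = l" "j \<noteq> k" | "i \<noteq> l" "j = k" | "i = l" "j = k"
    by blast
  then show ?thesis
  proof cases
    case 1
    then show ?thesis
      using assms M_off_diagonal by simp
  next
    case 2
    have "M i i j k - M 0 0 j k \<in> T"
    proof (cases "i = 0")
      case False
      then show ?thesis
        using M_left_diag[of 0 i j k] M_off_diagonal[of 0 i j k] assms n 2 by simp
    qed (simp add: T_zero)
    then show ?thesis
      using 2 by simp
  next
    case 3
    have "M i l j j - M i l 0 0 \<in> T"
    proof (cases "j = 0")
      case False
      then show ?thesis
        using M_right_diag[of i l 0 j] M_off_diagonal[of i l 0 j] assms n 3 by simp
    qed (simp add: T_zero)
    then show ?thesis
      using 3 by simp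
  next
    case 4
    show ?thesis
    proof (cases "i = 0 \<or> j = 0")
      case True
      \<comment> \<open>Here the four terms cancel in pairs.\<close>
      then show ?thesis
        using 4 by (auto simp: T_zero)
    next
      case False
      then have *: "M 0 i j j - M 0 i 0 0 \<in> T"
        using M_right_diag[of 0 i 0 j] M_off_diagonal[of 0 i 0 j] assms n 4 by simp
      \<comment> \<open>The factor \<open>delta (E i 0)\<close> turns the value \<open>E 0 i\<close>
        into \<open>E i i - E 0 0\<close>. Applied to a difference of two diagonal functionals, this
        produces all four terms.\<close>
      have "?C = delta (E i 0) * (M 0 i j j - M 0 i 0 0)"
        using 4 False assms n by (simp add: right_diff_distrib delta_mult_M)
      then show ?thesis
        using T_mult[OF T_delta *] by (simp only:)
    qed
  qed
qed

text \<open>Each \<open>M i l j k\<close> may be replaced by its corrected form, because the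
  corrections add up to zero: those for i = l collect the sums in \<open>mu_op\<close>, those for j
  = k the sums in \<open>mu\<close>.\<close>

lemma sum_M_in_T:
  assumes mu: "\<And>i l. i < n \<Longrightarrow> l < n \<Longrightarrow> (\<Sum>j<n. c i l j j) = 0"
    and mu_op: "\<And>j k. j < n \<Longrightarrow> k < n \<Longrightarrow> (\<Sum>i<n. c i i j k) = 0"
  shows "(\<Sum>i<n. \<Sum>l<n. \<Sum>j<n. \<Sum>k<n. c i l j k *\<^sub>C M i l j k) \<in> T" (is "?f \<in> T")
proof -
  let ?C1 = "\<lambda>i l j k. if i = l then M 0 0 j k else 0"
  let ?C2 = "\<lambda>i l j k. if j = k then M i l 0 0 else 0"
  let ?C3 = "\<lambda>i l j k. if i = l \<and> j = k then M 0 0 0 0 else 0"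
  let ?S = "\<lambda>C. \<Sum>i<n. \<Sum>l<n. \<Sum>j<n. \<Sum>k<n. c i l j k *\<^sub>C (C i l j k :: ('b, 'b opp) tensor)"
  have "?S ?C1 = (\<Sum>i<n. \<Sum>l<n. if i = l then \<Sum>j<n. \<Sum>k<n. c i l j k *\<^sub>C M 0 0 j k else 0)"
    by (intro sum.cong refl) simp
  also have "\<dots> = (\<Sum>i<n. \<Sum>j<n. \<Sum>k<n. c i i j k *\<^sub>C M 0 0 j k)"
    by simp
  also have "\<dots> = (\<Sum>j<n. \<Sum>i<n. \<Sum>k<n. c i i j k *\<^sub>C M 0 0 j k)"
    by (rule sum.swap)
  also have "\<dots> = (\<Sum>j<n. \<Sum>k<n. \<Sum>i<n. c i i j k *\<^sub>C M 0 0 j k)"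
    by (intro sum.cong refl sum.swap)
  also have "\<dots> = 0"
    by (simp add: mu_op flip: cvec.scale_sum_left)
  finally have 1: "?S ?C1 = 0" .
  have "?S ?C2 = (\<Sum>i<n. \<Sum>l<n. \<Sum>j<n. c i l j j *\<^sub>C M i l 0 0)"
    by (simp add: if_distrib[of "scaleC _"] cong: if_cong)
  also have "\<dots> = 0"
    by (simp add: mu flip: cvec.scale_sum_left)
  finally have 2: "?S ?C2 = 0" .
  \<comment> \<open>For the double correction the sum over j already vanishes for each fixed
    i.\<close>
  have "?S ?C3 = (\<Sum>i<n. \<Sum>l<n. if i = l then \<Sum>j<n. \<Sum>k<n. if j = k then c i l j k *\<^sub>C M 0 0 0 0 else 0 else 0)"
    by (intro sum.cong refl) (simp add: if_distrib[of "scaleC _"] cong: if_cong)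
  also have "\<dots> = (\<Sum>i<n. \<Sum>j<n. c i i j j *\<^sub>C M 0 0 0 0)"
    by simp
  also have "\<dots> = 0"
    by (simp add: mu flip: cvec.scale_sum_left)
  finally have 3: "?S ?C3 = 0" .
  have "?f = ?S (\<lambda>i l j k. M i l j k - ?C1 i l j k - ?C2 i l j k + ?C3 i l j k)"
    unfolding scaleC_add_right cvec.scale_right_diff_distrib sum.distrib sum_subtractf 1 2 3
    by simp
  also have "\<dots> \<in> T"
    by (intro T_sum T_scaleC M_corrected) auto
  finally show ?thesis .
qed

section \<open>The matrix algebra and the reduction to it\<close>

definition mat :: "(nat \<Rightarrow> nat \<Rightarrow> complex) \<Rightarrow> 'b"
  where "mat \<alpha> = (\<Sum>i<n. \<Sum>j<n. \<alpha> i j *\<^sub>C E i j)"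

lemma mat_mult: "mat \<alpha> * mat \<beta> = mat (\<lambda>i l. \<Sum>j<n. \<alpha> i j * \<beta> j l)"
proof -
  have "mat \<alpha> * mat \<beta> = (\<Sum>i<n. \<Sum>j<n. \<Sum>k<n. \<Sum>l<n. (\<alpha> i j * \<beta> k l) *\<^sub>C (E i j * E k l))"
    by (simp add: mat_def sum_distrib_right mult_scaleC_left)
      (simp add: sum_distrib_left mult_scaleC_right cvec.scale_sum_right scaleC_scaleC)
  also have "\<dots> = (\<Sum>i<n. \<Sum>j<n. \<Sum>k<n. if j = k then \<Sum>l<n. (\<alpha> i j * \<beta> k l) *\<^sub>C E i l else 0)"
    by (intro sum.cong refl) (simp add: E_mult)
  also have "\<dots> = (\<Sum>i<n. \<Sum>j<n. \<Sum>l<n. (\<alpha> i j * \<beta> j l) *\<^sub>C E i l)"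
    by simp
  also have "\<dots> = (\<Sum>i<n. \<Sum>l<n. \<Sum>j<n. (\<alpha> i j * \<beta> j l) *\<^sub>C E i l)"
    by (intro sum.cong refl sum.swap)
  finally show ?thesis
    by (simp add: mat_def cvec.scale_sum_left)
qed

lemma mat_add: "mat \<alpha> + mat \<beta> = mat (\<lambda>i j. \<alpha> i j + \<beta> i j)"
  by (simp add: mat_def scaleC_add_left sum.distrib)

lemma mat_scaleC: "c *\<^sub>C mat \<alpha> = mat (\<lambda>i j. c * \<alpha> i j)"
  by (simp add: mat_def cvec.scale_sum_right scaleC_scaleC)

lemma mat_sum: "(\<Sum>m\<in>A. mat (\<gamma> m)) = mat (\<lambda>i j. \<Sum>m\<in>A. \<gamma> m i j)"
  by (induction A rule: infinite_finite_induct) (simp_all add: mat_add, simp_all add: mat_def)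

text \<open>Compression by \<open>E p p\<close> and \<open>E q q\<close> isolates one coefficient,
  and \<open>E p q\<close> is nonzero.\<close>

lemma mat_eq_0:
  assumes "mat \<alpha> = 0" "p < n" "q < n"
  shows "\<alpha> p q = 0"
proof -
  have "0 = E p p * mat \<alpha> * E q q"
    using assms by simp
  also have "\<dots> = (\<Sum>i<n. \<Sum>j<n. if p = i then if j = q then \<alpha> i j *\<^sub>C E p q else 0 else 0)"
    unfolding mat_def sum_distrib_left sum_distrib_right mult_scaleC_left mult_scaleC_right
    using assms by (intro sum.cong refl) (auto simp: E_mult)
  also have "\<dots> = (\<Sum>i<n. if p = i then \<Sum>j<n. if j = q then \<alpha> i j *\<^sub>C E p q else 0 else 0)"
    by (intro sum.cong refl) simp
  also have "\<dots> = \<alpha> p q *\<^sub>C E p q"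
    using assms by simp
  finally show ?thesis
    using E_nonzero[of p q] assms by simp
qed

lemma tens_mat:
  "tens (mat \<alpha>) (mat \<beta>) = (\<Sum>i<n. \<Sum>l<n. \<Sum>j<n. \<Sum>k<n. (\<alpha> i j * \<beta> k l) *\<^sub>C M i l j k)"
proof -
  have "tens (mat \<alpha>) (mat \<beta>) = (\<Sum>i<n. \<Sum>j<n. \<Sum>k<n. \<Sum>l<n. (\<alpha> i j * \<beta> k l) *\<^sub>C M i l j k)"
    by (simp add: mat_def tens_sum_left tens_scaleC_left)
      (simp add: tens_sum_right tens_scaleC_right M_def cvec.scale_sum_right scaleC_scaleC)
  also have "\<dots> = (\<Sum>i<n. \<Sum>j<n. \<Sum>l<n. \<Sum>k<n. (\<alpha> i j * \<beta> k l) *\<^sub>C M i l j k)"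
    by (intro sum.cong refl sum.swap)
  also have "\<dots> = (\<Sum>i<n. \<Sum>l<n. \<Sum>j<n. \<Sum>k<n. (\<alpha> i j * \<beta> k l) *\<^sub>C M i l j k)"
    by (intro sum.cong refl sum.swap)
  finally show ?thesis .
qed

text \<open>Read entrywise, the two vanishing sums of products are the two contractions of the
  coefficient array that \<open>sum_M_in_T\<close> requires to be zero.\<close>

lemma sum_tens_mat_in_T:
  fixes N :: nat
  assumes mu: "(\<Sum>m<N. mat (\<alpha> m) * mat (\<beta> m)) = 0"
    and mu_op: "(\<Sum>m<N. mat (\<beta> m) * mat (\<alpha> m)) = 0"
  shows "(\<Sum>m<N. tens (mat (\<alpha> m)) (mat (\<beta> m))) \<in> T"
proof -
  let ?c = "\<lambda>i l j k. \<Sum>m<N. \<alpha> m i j * \<beta> m k l"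
  have "(\<Sum>m<N. tens (mat (\<alpha> m)) (mat (\<beta> m))) = (\<Sum>i<n. \<Sum>l<n. \<Sum>j<n. \<Sum>k<n. ?c i l j k *\<^sub>C M i l j k)"
    unfolding tens_mat cvec.scale_sum_left
    by (simp only: sum.swap[where A = "{..<N}" and B = "{..<n}"])
  also have "\<dots> \<in> T"
  proof (rule sum_M_in_T)
    fix i l
    assume "i < n" "l < n"
    then have "(\<Sum>m<N. \<Sum>j<n. \<alpha> m i j * \<beta> m j l) = 0"
      using mat_eq_0[OF mu[unfolded mat_mult mat_sum]] by simp
    then show "(\<Sum>j<n. ?c i l j j) = 0"
      by (subst sum.swap)
  next
    fix j k
    assume "j < n" "k < n"
    then have "(\<Sum>m<N. \<Sum>i<n. \<beta> m k i * \<alpha> m i j) = 0"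
      using mat_eq_0[OF mu_op[unfolded mat_mult mat_sum]] by simp
    then show "(\<Sum>i<n. ?c i i j k) = 0"
      by (subst sum.swap) (simp add: mult.commute)
  qed
  finally show ?thesis .
qed

text \<open>Let e be the unit of the matrix algebra. The part of the tensor in the corner e B e
  falls under \<open>sum_tens_mat_in_T\<close>, the mixed terms with 1 - e fall under
  \<open>T_tens_complement\<close>, and the remaining multiples of
  \<open>tens 1 1 - tens e e\<close> sum to zero.\<close>

lemma kernel_in_T:
  fixes N :: nat
  assumes a: "\<And>m. m < N \<Longrightarrow> a m = mat (\<alpha> m) + c m *\<^sub>C 1"
    and b: "\<And>m. m < N \<Longrightarrow> b m = mat (\<beta> m) + d m *\<^sub>C 1"
    and mu: "(\<Sum>m<N. a m * b m) = 0" and mu_op: "(\<Sum>m<N. b m * a m) = 0"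
  shows "(\<Sum>m<N. tens (a m) (b m)) \<in> T"
proof -
  define e where "e = mat (\<lambda>i j. if i = j then 1 else 0)"
  have e_left: "e * mat \<gamma> = mat \<gamma>" for \<gamma>
    unfolding e_def mat_mult unfolding mat_def
    by (intro sum.cong refl) (simp add: if_distrib[of "\<lambda>x. x * _"] cong: if_cong)
  have e_right: "mat \<gamma> * e = mat \<gamma>" for \<gamma>
    unfolding e_def mat_mult unfolding mat_def
    by (intro sum.cong refl) (simp add: if_distrib[of "\<lambda>x. _ * x"] cong: if_cong)
  have e: "e * e = e"
    unfolding e_def using e_left e_def by metis
  \<comment> \<open>The scalar part is absorbed into the diagonal, so that
    \<open>mat (\<alpha>' m)\<close> is the compression of \<open>a m\<close> by e.\<close>
  define \<alpha>' \<beta>' where "\<alpha>' = (\<lambda>m i j. \<alpha> m i j + c m * (if i = j then 1 else 0))"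
    and "\<beta>' = (\<lambda>m i j. \<beta> m i j + d m * (if i = j then 1 else 0))"
  have \<alpha>': "mat (\<alpha>' m) = mat (\<alpha> m) + c m *\<^sub>C e" and \<beta>': "mat (\<beta>' m) = mat (\<beta> m) + d m *\<^sub>C e" for m
    by (simp_all add: \<alpha>'_def \<beta>'_def e_def mat_add mat_scaleC)
  have ea: "mat (\<alpha>' m) = e * a m" and eb: "mat (\<beta>' m) = e * b m" if "m < N" for m
    by (simp_all add: a[OF that] b[OF that] \<alpha>' \<beta>' distrib_left e_left mult_scaleC_right)
  \<comment> \<open>This makes the product of two compressions the compression of the product, so
    both kernel equations pass to the corner.\<close>
  have ae: "e * a m * e = e * a m" and be: "e * b m * e = e * b m" if "m < N" for m
    by (simp_all add: e_right flip: ea[OF that] eb[OF that])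
  have "(\<Sum>m<N. mat (\<alpha>' m) * mat (\<beta>' m)) = e * (\<Sum>m<N. a m * b m)"
    unfolding sum_distrib_left
    by (intro sum.cong refl) (simp add: ea eb ae flip: mult.assoc)
  moreover have "(\<Sum>m<N. mat (\<beta>' m) * mat (\<alpha>' m)) = e * (\<Sum>m<N. b m * a m)"
    unfolding sum_distrib_left
    by (intro sum.cong refl) (simp add: ea eb be flip: mult.assoc)
  ultimately have core: "(\<Sum>m<N. tens (mat (\<alpha>' m)) (mat (\<beta>' m))) \<in> T"
    by (intro sum_tens_mat_in_T) (simp_all add: mu mu_op)
  txt \<open>The scalar part vanishes unless \<open>e = 1\<close>, which happens for finite-dimensional \<open>X\<close>.\<close>
  define \<gamma> where "\<gamma> = (\<Sum>m<N. c m * d m)"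
  have "(1 - e) * a m = c m *\<^sub>C (1 - e)" and "(1 - e) * b m = d m *\<^sub>C (1 - e)" if "m < N" for m
    by (simp_all add: a[OF that] b[OF that] left_diff_distrib distrib_left e_left mult_scaleC_right
        cvec.scale_right_diff_distrib)
  then have "(1 - e) * (a m * b m) = (c m * d m) *\<^sub>C (1 - e)" if "m < N" for m
    using that by (simp add: mult_scaleC_left scaleC_scaleC flip: mult.assoc)
  then have "(1 - e) * (\<Sum>m<N. a m * b m) = \<gamma> *\<^sub>C (1 - e)"
    by (simp add: sum_distrib_left \<gamma>_def cvec.scale_sum_left)
  then have "\<gamma> = 0 \<or> 1 = e"
    by (simp add: mu)
  then have unit: "\<gamma> *\<^sub>C (tens 1 1 - tens e e) = 0"
    by auto
  have "tens (a m) (b m) - tens (mat (\<alpha>' m)) (mat (\<beta>' m)) =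
      d m *\<^sub>C tens (mat (\<alpha> m)) (1 - e) + c m *\<^sub>C tens (1 - e) (mat (\<beta> m))
      + (c m * d m) *\<^sub>C (tens 1 1 - tens e e)" if "m < N" for m
    by (simp add: a[OF that] b[OF that] \<alpha>' \<beta>' tens_add_left tens_add_right tens_diff_left
        tens_diff_right tens_scaleC_left tens_scaleC_right scaleC_add_right scaleC_scaleC
        cvec.scale_right_diff_distrib mult.commute)
  then have "(\<Sum>m<N. tens (a m) (b m)) - (\<Sum>m<N. tens (mat (\<alpha>' m)) (mat (\<beta>' m))) =
      (\<Sum>m<N. d m *\<^sub>C tens (mat (\<alpha> m)) (1 - e) + c m *\<^sub>C tens (1 - e) (mat (\<beta> m)))
      + \<gamma> *\<^sub>C (tens 1 1 - tens e e)"
    by (simp add: \<gamma>_def cvec.scale_sum_left sum.distrib flip: sum_subtractf)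
  also have "\<dots> \<in> T"
    unfolding unit add_0_right
    by (intro T_sum T_add T_scaleC T_tens_complement e e_left e_right)
  finally show ?thesis
    using T_add[OF _ core] by fastforce
qed

end
end

section \<open>Biorthogonal systems and finite-rank operators\<close>

definition act :: "'a::complex_vector finrank_unital \<Rightarrow> 'a \<Rightarrow> 'a"
  where "act B = app (Rep_finrank_unital B)"

lemma act_eqI: "(\<And>z. act B z = act C z) \<Longrightarrow> B = C"
  by (metis Rep_finrank_unital_inject act_def app_inject ext)

lemma act_add: "act (B + C) z = act B z + act C z"
  by (simp add: act_def plus_finrank_unital.rep_eq plus_linop.rep_eq)

lemma act_scaleC: "act (c *\<^sub>C B) z = c *\<^sub>C act B z"
  by (simp add: act_def scaleC_finrank_unital.rep_eq scaleC_linop.rep_eq)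

lemma act_mult: "act (B * C) z = act B (act C z)"
  by (simp add: act_def times_finrank_unital.rep_eq times_linop.rep_eq)

lemma act_zero: "act 0 z = 0"
  by (simp add: act_def zero_finrank_unital.rep_eq zero_linop.rep_eq)

lemma act_one: "act 1 z = z"
  by (simp add: act_def one_finrank_unital.rep_eq one_linop.rep_eq)

lemma act_sum: "act (\<Sum>i\<in>I. f i) z = (\<Sum>i\<in>I. act (f i) z)"
  by (induction I rule: infinite_finite_induct) (simp_all add: act_zero act_add)

definition rank_one :: "'a::complex_vector \<Rightarrow> ('a \<Rightarrow> complex) \<Rightarrow> 'a finrank_unital"
  where "rank_one v \<eta> = Abs_finrank_unital (Linop (\<lambda>z. \<eta> z *\<^sub>C v))"

lemma act_rank_one:
  assumes "clinear \<eta>"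
  shows "act (rank_one v \<eta>) z = \<eta> z *\<^sub>C v"
proof -
  have lin: "(\<lambda>z. \<eta> z *\<^sub>C v) \<in> {f. clinear f}"
    using assms by (simp add: clinear_iff scaleC_add_left scaleC_scaleC scaleC_complex_def)
  have "Linop (\<lambda>z. \<eta> z *\<^sub>C v) \<in> finite_rank"
    unfolding finite_rank_def
    by (auto simp: Linop_inverse[OF lin] cvec.span_singleton intro!: exI[of _ "{v}"] rangeI)
  then have "Linop (\<lambda>z. \<eta> z *\<^sub>C v) \<in> finrank_unital_set"
    unfolding finrank_unital_set_def by force
  then show ?thesis
    by (simp add: act_def rank_one_def Abs_finrank_unital_inverse Linop_inverse[OF lin])
qed

lemma clinear_sum: "clinear f \<Longrightarrow> f (\<Sum>i\<in>I. g i) = (\<Sum>i\<in>I. f (g i))"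
  using module_hom.sum[of scaleC scaleC f g I] by (simp add: linear_iff_module_hom)

text \<open>A nonzero vector forms an independent set, on which the value 1 can be prescribed and
  extended linearly.\<close>

lemma exists_functional:
  fixes v :: "'a::complex_vector"
  assumes "v \<noteq> 0"
  shows "\<exists>h :: 'a \<Rightarrow> complex. clinear h \<and> h v = 1"
proof -
  interpret vp: vector_space_pair "scaleC :: complex \<Rightarrow> 'a \<Rightarrow> 'a" "scaleC :: complex \<Rightarrow> complex \<Rightarrow> complex"
    by unfold_locales
  have "cvec.independent {v}"
    using assms by simp
  from vp.linear_independent_extend[OF this, of "\<lambda>_. 1"] show ?thesis
    by auto
qed

section \<open>Enlarging biorthogonal systems\<close>

definition biorthogonal ::
    "nat \<Rightarrow> (nat \<Rightarrow> 'a::complex_vector) \<Rightarrow> (nat \<Rightarrow> 'a \<Rightarrow> complex) \<Rightarrow> bool"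
  where "biorthogonal n v \<eta> \<longleftrightarrow> (\<forall>i<n. clinear (\<eta> i)) \<and>
    (\<forall>i<n. \<forall>j<n. \<eta> i (v j) = (if i = j then 1 else 0))"

text \<open>For a biorthogonal system this is the projection onto the span of the \<open>v i\<close>
  along the common kernel of the \<open>\<eta> i\<close>.\<close>

definition proj ::
    "nat \<Rightarrow> (nat \<Rightarrow> 'a::complex_vector) \<Rightarrow> (nat \<Rightarrow> 'a \<Rightarrow> complex) \<Rightarrow> 'a \<Rightarrow> 'a"
  where "proj n v \<eta> z = (\<Sum>i<n. \<eta> i z *\<^sub>C v i)"

lemma clinear_proj:
  assumes "biorthogonal n v \<eta>"
  shows "clinear (proj n v \<eta>)"
  using assms
  by (simp add: biorthogonal_def clinear_iff proj_def scaleC_add_left sum.distrib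
      cvec.scale_sum_right scaleC_scaleC scaleC_complex_def)

lemma functional_proj:
  assumes "biorthogonal n v \<eta>" "i < n"
  shows "\<eta> i (proj n v \<eta> z) = \<eta> i z"
proof -
  have \<eta>: "clinear (\<eta> i)"
    using assms by (simp add: biorthogonal_def)
  then have scale: "\<eta> i (c *\<^sub>C x) = c * \<eta> i x" for c x
    by (simp add: clinear_iff scaleC_complex_def)
  have "\<eta> i (proj n v \<eta> z) = (\<Sum>j<n. \<eta> j z * \<eta> i (v j))"
    by (simp add: proj_def clinear_sum[OF \<eta>] scale)
  also have "\<dots> = (\<Sum>j<n. if i = j then \<eta> j z else 0)"
    using assms by (intro sum.cong refl) (simp add: biorthogonal_def)
  finally show ?thesis
    using assms by simp
qed

lemma proj_idem:
  assumes "biorthogonal n v \<eta>"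
  shows "proj n v \<eta> (proj n v \<eta> z) = proj n v \<eta> z"
  unfolding proj_def[of _ _ _ "proj n v \<eta> z"] by (simp add: functional_proj[OF assms]) (simp add: proj_def)

lemma biorthogonal_extend:
  assumes b: "biorthogonal n v \<eta>" and w: "proj n v \<eta> w = 0" and h: "clinear h"
    and hp: "\<And>z. h (proj n v \<eta> z) = 0" and hw: "h w = 1"
  shows "\<exists>v' \<eta>'. biorthogonal (Suc n) v' \<eta>' \<and>
    (\<forall>z. proj (Suc n) v' \<eta>' z = proj n v \<eta> z + h z *\<^sub>C w)"
proof (intro exI conjI)
  \<comment> \<open>Orthogonality to the old functionals follows from p w = 0 by
    \<open>functional_proj\<close>. Dually, h kills every \<open>v j\<close> because p fixes
    it.\<close>
  have "\<eta> i w = 0" if "i < n" for i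
  proof -
    have "\<eta> i 0 = 0"
      using b that clinear_sum[of "\<eta> i" _ "{}"] by (simp add: biorthogonal_def)
    then show ?thesis
      using functional_proj[OF b that, of w] w by simp
  qed
  moreover have "h (v j) = 0" if "j < n" for j
  proof -
    have "proj n v \<eta> (v j) = (\<Sum>i<n. if i = j then v i else 0)"
      unfolding proj_def using b that
      by (intro sum.cong refl) (simp add: biorthogonal_def scaleC_one)
    then show ?thesis
      using hp[of "v j"] that by simp
  qed
  ultimately show "biorthogonal (Suc n) (v(n := w)) (\<eta>(n := h))"
    using b h hw by (auto simp: biorthogonal_def less_Suc_eq)
  show "\<forall>z. proj (Suc n) (v(n := w)) (\<eta>(n := h)) z = proj n v \<eta> z + h z *\<^sub>C w"
    by (simp add: proj_def)
qed

text \<open>The defect w = s - p s becomes the new vector. A functional with value 1 at w, composed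
  with 1 - p, becomes the new functional; it vanishes on everything p already fixes.\<close>

lemma biorthogonal_extend_vector:
  fixes s :: "'a::complex_vector"
  assumes b: "biorthogonal n v \<eta>"
  shows "\<exists>n' v' \<eta>'. biorthogonal n' v' \<eta>' \<and> proj n' v' \<eta>' s = s \<and>
    (\<forall>x. proj n v \<eta> x = x \<longrightarrow> proj n' v' \<eta>' x = x)"
proof (cases "proj n v \<eta> s = s")
  case False
  let ?p = "proj n v \<eta>"
  define w where "w = s - ?p s"
  have p: "?p (x + y) = ?p x + ?p y" "?p (c *\<^sub>C x) = c *\<^sub>C ?p x" for x y c
    using clinear_proj[OF b] by (simp_all add: clinear_iff)
  have pdiff: "?p (x - y) = ?p x - ?p y" for x y
    using p(1)[of "x - y" y] by (simp add: algebra_simps)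
  obtain h0 :: "'a \<Rightarrow> complex" where h0: "clinear h0" "h0 w = 1"
    using exists_functional[of w] False by (auto simp: w_def)
  define h where "h = (\<lambda>z. h0 (z - ?p z))"
  have h: "clinear h"
    using h0(1) by (simp add: h_def clinear_iff p add_diff_add flip: cvec.scale_right_diff_distrib)
  have h00: "h0 0 = 0"
    using clinear_sum[OF h0(1), of _ "{}"] by simp
  have pw: "?p w = 0"
    by (simp add: w_def pdiff proj_idem[OF b])
  obtain v' \<eta>' where ext: "biorthogonal (Suc n) v' \<eta>'"
    "\<And>z. proj (Suc n) v' \<eta>' z = ?p z + h z *\<^sub>C w"
    using biorthogonal_extend[OF b pw h] h0(2) h00 by (auto simp: h_def proj_idem[OF b] pw)
  have "h s = 1"
    using h0(2) by (simp add: h_def w_def)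
  then have "proj (Suc n) v' \<eta>' s = s"
    by (simp add: ext(2) w_def scaleC_one)
  moreover have "proj (Suc n) v' \<eta>' x = x" if "?p x = x" for x
    by (simp add: ext(2) that h_def h00)
  ultimately show ?thesis
    using ext(1) by blast
qed (use b in blast)

text \<open>Dual to the previous construction: the defect of \<open>\<tau>\<close> under p becomes
  the new functional. The new vector lies in the range of 1 - p, so every functional already
  preserved by p vanishes on it and stays preserved.\<close>

lemma biorthogonal_extend_functional:
  fixes \<tau> :: "'a::complex_vector \<Rightarrow> complex"
  assumes b: "biorthogonal n v \<eta>" and \<tau>: "clinear \<tau>"
  shows "\<exists>n' v' \<eta>'. biorthogonal n' v' \<eta>' \<and> (\<forall>z. \<tau> (proj n' v' \<eta>' z) = \<tau> z) \<and>
    (\<forall>x. proj n v \<eta> x = x \<longrightarrow> proj n' v' \<eta>' x = x) \<and>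
    (\<forall>\<sigma> :: 'a \<Rightarrow> complex. clinear \<sigma> \<longrightarrow> (\<forall>z. \<sigma> (proj n v \<eta> z) = \<sigma> z) \<longrightarrow>
      (\<forall>z. \<sigma> (proj n' v' \<eta>' z) = \<sigma> z))"
proof (cases "\<forall>z. \<tau> (proj n v \<eta> z) = \<tau> z")
  case False
  let ?p = "proj n v \<eta>"
  have p: "?p (x + y) = ?p x + ?p y" "?p (c *\<^sub>C x) = c *\<^sub>C ?p x" for x y c
    using clinear_proj[OF b] by (simp_all add: clinear_iff)
  have pdiff: "?p (x - y) = ?p x - ?p y" for x y
    using p(1)[of "x - y" y] by (simp add: algebra_simps)
  have lin: "\<sigma> (x + y) = \<sigma> x + \<sigma> y" "\<sigma> (c *\<^sub>C x) = c * \<sigma> x" "\<sigma> (x - y) = \<sigma> x - \<sigma> y"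
    if "clinear \<sigma>" for \<sigma> :: "'a \<Rightarrow> complex" and x y c
  proof -
    show add: "\<sigma> (x + y) = \<sigma> x + \<sigma> y" for x y
      using that by (simp add: clinear_iff)
    show "\<sigma> (c *\<^sub>C x) = c * \<sigma> x"
      using that by (simp add: clinear_iff scaleC_complex_def)
    show "\<sigma> (x - y) = \<sigma> x - \<sigma> y"
      using add[of "x - y" y] by (simp add: algebra_simps)
  qed
  obtain z0 where "\<tau> (?p z0) \<noteq> \<tau> z0"
    using False by blast
  then have z0: "\<tau> z0 - \<tau> (?p z0) \<noteq> 0"
    by simp
  \<comment> \<open>The scalar normalises w to \<open>\<tau> w = 1\<close>.\<close>
  define w where "w = (1 / (\<tau> z0 - \<tau> (?p z0))) *\<^sub>C (z0 - ?p z0)"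
  define h where "h = (\<lambda>z. \<tau> (z - ?p z))"
  have h: "clinear h"
    using \<tau> by (simp add: h_def clinear_iff p add_diff_add flip: cvec.scale_right_diff_distrib)
  have pw: "?p w = 0"
    by (simp add: w_def p pdiff proj_idem[OF b])
  have \<tau>w: "\<tau> w = 1"
    using z0 by (simp add: w_def lin[OF \<tau>])
  have \<tau>0: "\<tau> 0 = 0"
    using clinear_sum[OF \<tau>, of _ "{}"] by simp
  obtain v' \<eta>' where ext: "biorthogonal (Suc n) v' \<eta>'"
    "\<And>z. proj (Suc n) v' \<eta>' z = ?p z + h z *\<^sub>C w"
    using biorthogonal_extend[OF b pw h] \<tau>w \<tau>0 by (auto simp: h_def proj_idem[OF b] pw)
  have "\<tau> (proj (Suc n) v' \<eta>' z) = \<tau> z" for z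
    by (simp add: ext(2) lin[OF \<tau>] h_def \<tau>w)
  moreover have "proj (Suc n) v' \<eta>' x = x" if "?p x = x" for x
    by (simp add: ext(2) that h_def \<tau>0)
  moreover have "\<sigma> (proj (Suc n) v' \<eta>' z) = \<sigma> z"
    if \<sigma>: "clinear \<sigma>" and fixed: "\<And>z. \<sigma> (?p z) = \<sigma> z" for \<sigma> :: "'a \<Rightarrow> complex" and z
  proof -
    have "\<sigma> w = 0"
      by (simp add: w_def lin[OF \<sigma>] fixed)
    then show ?thesis
      by (simp add: ext(2) lin[OF \<sigma>] fixed)
  qed
  ultimately show ?thesis
    using ext(1) by blast
qed (use b in blast)

lemma biorthogonal_fixing_vectors:
  fixes S :: "'a::complex_vector set"
  assumes "finite S"
  shows "\<exists>n v \<eta>. biorthogonal n v \<eta> \<and> (\<forall>s\<in>S. proj n v \<eta> s = s)"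
  using assms
proof (induction S rule: finite_induct)
  case empty
  have "biorthogonal 0 (\<lambda>_. 0 :: 'a) (\<lambda>_ _. 0)"
    by (simp add: biorthogonal_def)
  then show ?case
    by blast
next
  case (insert s S)
  then obtain n v \<eta> where b: "biorthogonal n v \<eta>" and S: "\<forall>s\<in>S. proj n v \<eta> s = s"
    by blast
  obtain n' v' \<eta>' where "biorthogonal n' v' \<eta>'" "proj n' v' \<eta>' s = s"
    "\<forall>x. proj n v \<eta> x = x \<longrightarrow> proj n' v' \<eta>' x = x"
    using biorthogonal_extend_vector[OF b] by blast
  with S show ?case
    by (intro exI[of _ n'] exI[of _ v'] exI[of _ \<eta>']) auto
qed

text \<open>Starting from a given system and keeping its fixed vectors allows vectors to be treated
  first and functionals afterwards.\<close>

lemma biorthogonal_fixing_functionals: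
  fixes G :: "('a::complex_vector \<Rightarrow> complex) set"
  assumes "finite G" "\<forall>\<tau>\<in>G. clinear \<tau>" and b: "biorthogonal n v \<eta>"
  shows "\<exists>n' v' \<eta>'. biorthogonal n' v' \<eta>' \<and> (\<forall>\<tau>\<in>G. \<forall>z. \<tau> (proj n' v' \<eta>' z) = \<tau> z) \<and>
    (\<forall>x. proj n v \<eta> x = x \<longrightarrow> proj n' v' \<eta>' x = x)"
  using assms(1,2)
proof (induction G rule: finite_induct)
  case empty
  then show ?case
    using b by blast
next
  case (insert \<tau> G)
  then obtain n1 v1 \<eta>1 where b1: "biorthogonal n1 v1 \<eta>1"
    and G: "\<forall>\<tau>\<in>G. \<forall>z. \<tau> (proj n1 v1 \<eta>1 z) = \<tau> z"
    and x: "\<forall>x. proj n v \<eta> x = x \<longrightarrow> proj n1 v1 \<eta>1 x = x"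
    by blast
  have \<tau>: "clinear \<tau>"
    using insert.prems by simp
  obtain n2 v2 \<eta>2 where "biorthogonal n2 v2 \<eta>2" "\<forall>z. \<tau> (proj n2 v2 \<eta>2 z) = \<tau> z"
    "\<forall>x. proj n1 v1 \<eta>1 x = x \<longrightarrow> proj n2 v2 \<eta>2 x = x"
    "\<forall>\<sigma> :: 'a \<Rightarrow> complex. clinear \<sigma> \<longrightarrow> (\<forall>z. \<sigma> (proj n1 v1 \<eta>1 z) = \<sigma> z) \<longrightarrow>
      (\<forall>z. \<sigma> (proj n2 v2 \<eta>2 z) = \<sigma> z)"
    using biorthogonal_extend_functional[OF b1 \<tau>] by blast
  with G x insert.prems show ?case
    by (intro exI[of _ n2] exI[of _ v2] exI[of _ \<eta>2]) auto
qed

text \<open>A first system fixes spanning sets of all the ranges, which gives p T = T. Enlarging it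
  to preserve finitely many functionals then gives T p = T as well.\<close>

lemma biorthogonal_fixing_operators:
  fixes K :: "'a::complex_vector linop set"
  assumes "finite K" "K \<subseteq> finite_rank"
  shows "\<exists>n v \<eta>. biorthogonal n v \<eta> \<and>
    (\<forall>T\<in>K. \<forall>z. proj n v \<eta> (app T z) = app T z \<and> app T (proj n v \<eta> z) = app T z)"
proof -
  have "\<forall>T\<in>K. \<exists>S. finite S \<and> range (app T) \<subseteq> cvec.span S"
    using assms(2) by (auto simp: finite_rank_def)
  then obtain S where S: "\<forall>T\<in>K. finite (S T) \<and> range (app T) \<subseteq> cvec.span (S T)"
    by (rule bchoice[THEN exE])
  then have fin: "finite (\<Union>T\<in>K. S T)"
    using assms(1) by blast
  obtain n v \<eta> where b: "biorthogonal n v \<eta>" and fixed: "\<forall>s\<in>(\<Union>T\<in>K. S T). proj n v \<eta> s = s"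
    using biorthogonal_fixing_vectors[OF fin] by blast
  have p: "proj n v \<eta> (x + y) = proj n v \<eta> x + proj n v \<eta> y"
    "proj n v \<eta> (c *\<^sub>C x) = c *\<^sub>C proj n v \<eta> x" for x y c
    using clinear_proj[OF b] by (simp_all add: clinear_iff)
  have "cvec.span (S T) \<subseteq> {x. proj n v \<eta> x = x}" if "T \<in> K" for T
  proof (rule cvec.span_minimal)
    show "cvec.subspace {x. proj n v \<eta> x = x}"
      using p p(2)[of 0 0] by (auto simp: cvec.subspace_def)
  qed (use fixed that in auto)
  then have left: "proj n v \<eta> (app T z) = app T z" if "T \<in> K" for T z
    using S that by blast
  \<comment> \<open>As p T = T for the first system, the finitely many functionals
    \<open>\<eta> i\<close> composed with T determine T.\<close>
  let ?G = "(\<lambda>(T, i) z. \<eta> i (app T z)) ` (K \<times> {..<n})"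
  have fin_G: "finite ?G"
    using assms(1) by simp
  have lin_G: "\<forall>\<tau>\<in>?G. clinear \<tau>"
  proof -
    have "clinear (app T)" for T :: "'a linop"
      using app[of T] by simp
    then show ?thesis
      using b by (auto simp: biorthogonal_def clinear_iff)
  qed
  obtain n' v' \<eta>' where b': "biorthogonal n' v' \<eta>'"
    and G: "\<forall>\<tau>\<in>?G. \<forall>z. \<tau> (proj n' v' \<eta>' z) = \<tau> z"
    and ext: "\<forall>x. proj n v \<eta> x = x \<longrightarrow> proj n' v' \<eta>' x = x"
    using biorthogonal_fixing_functionals[OF fin_G lin_G b] by blast
  have "app T (proj n' v' \<eta>' z) = app T z" if "T \<in> K" for T z
  proof -
    have "app T (proj n' v' \<eta>' z) = proj n v \<eta> (app T (proj n' v' \<eta>' z))"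
      using left that by simp
    also have "\<dots> = proj n v \<eta> (app T z)"
      unfolding proj_def[of n v] using G that by (intro sum.cong refl) auto
    finally show ?thesis
      using left that by simp
  qed
  moreover have "proj n' v' \<eta>' (app T z) = app T z" if "T \<in> K" for T z
    using ext left that by simp
  ultimately show ?thesis
    using b' by (intro exI[of _ n'] exI[of _ v'] exI[of _ \<eta>']) simp
qed

section \<open>Matrix units and coordinates from a biorthogonal system\<close>

lemma rank_one_matrix_units:
  assumes b: "biorthogonal n v \<eta>"
  shows "i < n \<Longrightarrow> j < n \<Longrightarrow> k < n \<Longrightarrow> l < n \<Longrightarrow>
      rank_one (v i) (\<eta> j) * rank_one (v k) (\<eta> l) = (if j = k then rank_one (v i) (\<eta> l) else 0)"
    and "i < n \<Longrightarrow> j < n \<Longrightarrow> rank_one (v i) (\<eta> j) \<noteq> 0"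
proof -
  have \<eta>: "clinear (\<eta> j)" if "j < n" for j
    using b that by (simp add: biorthogonal_def)
  have scale: "\<eta> j (c *\<^sub>C x) = c * \<eta> j x" if "j < n" for j c x
    using \<eta>[OF that] by (simp add: clinear_iff scaleC_complex_def)
  have dual: "\<eta> j (v k) = (if j = k then 1 else 0)" if "j < n" "k < n" for j k
    using b that by (simp add: biorthogonal_def)
  show "rank_one (v i) (\<eta> j) * rank_one (v k) (\<eta> l) = (if j = k then rank_one (v i) (\<eta> l) else 0)"
    if "i < n" "j < n" "k < n" "l < n"
    using that by (intro act_eqI) (simp add: act_mult act_rank_one \<eta> scale dual act_zero)
  show "rank_one (v i) (\<eta> j) \<noteq> 0" if ij: "i < n" "j < n"
  proof
    assume "rank_one (v i) (\<eta> j) = 0"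
    then have "act (rank_one (v i) (\<eta> j)) (v j) = 0"
      by (simp add: act_zero)
    then have "v i = 0"
      using ij by (simp add: act_rank_one \<eta> dual scaleC_one)
    \<comment> \<open>The vector \<open>v i\<close> cannot be zero, as \<open>\<eta> i\<close> takes
      the value 1 on it.\<close>
    then show False
      using scale[OF ij(1), of 0 0] dual[OF ij(1) ij(1)] by simp
  qed
qed

text \<open>The two hypotheses say T = p T p; expanding both projections yields the entries.\<close>

lemma finrank_unital_eq_mat:
  assumes b: "biorthogonal n v \<eta>" and B: "Rep_finrank_unital B = T + c *\<^sub>C 1"
    and left: "\<And>z. proj n v \<eta> (app T z) = app T z"
    and right: "\<And>z. app T (proj n v \<eta> z) = app T z"
  shows "B = mat n (\<lambda>i j. rank_one (v i) (\<eta> j)) (\<lambda>i j. \<eta> i (app T (v j))) + c *\<^sub>C 1"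
proof (rule act_eqI)
  fix z
  have \<eta>: "clinear (\<eta> i)" if "i < n" for i
    using b that by (simp add: biorthogonal_def)
  have T: "clinear (app T)"
    using app[of T] by simp
  have "act B z = app T z + c *\<^sub>C z"
    by (simp add: act_def B plus_linop.rep_eq scaleC_linop.rep_eq one_linop.rep_eq)
  moreover have "app T z = (\<Sum>i<n. \<Sum>j<n. \<eta> i (app T (v j)) *\<^sub>C \<eta> j z *\<^sub>C v i)"
  proof -
    have "app T z = (\<Sum>i<n. \<eta> i (app T (proj n v \<eta> z)) *\<^sub>C v i)"
      unfolding right by (simp add: left flip: proj_def)
    also have "\<dots> = (\<Sum>i<n. (\<Sum>j<n. \<eta> i (app T (v j)) * \<eta> j z) *\<^sub>C v i)"
    proof (intro sum.cong refl arg_cong2[where f = scaleC])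
      fix i
      assume "i \<in> {..<n}"
      then have lin: "clinear (\<eta> i)"
        using \<eta> by simp
      have "\<eta> i (app T (c *\<^sub>C x)) = \<eta> i (app T x) * c" for c x
        using lin T by (simp add: clinear_iff scaleC_complex_def mult.commute)
      then show "\<eta> i (app T (proj n v \<eta> z)) = (\<Sum>j<n. \<eta> i (app T (v j)) * \<eta> j z)"
        by (simp add: proj_def clinear_sum[OF T] clinear_sum[OF lin])
    qed
    finally show ?thesis
      by (simp add: cvec.scale_sum_left scaleC_scaleC)
  qed
  ultimately show "act B z = act (mat n (\<lambda>i j. rank_one (v i) (\<eta> j))
      (\<lambda>i j. \<eta> i (app T (v j))) + c *\<^sub>C 1) z"
    by (simp add: mat_def[OF rank_one_matrix_units[OF b]] act_add act_sum act_scaleC act_one act_rank_one \<eta>)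
qed

theorem theorem2p13:
  shows "T_Lie TYPE('a::complex_vector finrank_unital) = N_Lie TYPE('a finrank_unital)"
proof (rule antisym[OF T_Lie_subset_N_Lie], rule subsetI)
  fix t :: "('a finrank_unital, 'a finrank_unital opp) tensor"
  assume "t \<in> N_Lie TYPE('a finrank_unital)"
  then obtain N :: nat and a b :: "nat \<Rightarrow> 'a finrank_unital"
    where t: "t = (\<Sum>m<N. tens (a m) (b m))"
      and mu: "(\<Sum>m<N. a m * b m) = 0" and mu_op: "(\<Sum>m<N. b m * a m) = 0"
    unfolding N_Lie_def tens_def by blast
  have "\<exists>T c. T \<in> finite_rank \<and> Rep_finrank_unital B = T + c *\<^sub>C 1" for B :: "'a finrank_unital"
    using Rep_finrank_unital[of B] unfolding finrank_unital_set_def by blast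
  \<comment> \<open>If X is finite-dimensional the splitting is not unique, so one is chosen for
    each element.\<close>
  then obtain F :: "'a finrank_unital \<Rightarrow> 'a linop" and c :: "'a finrank_unital \<Rightarrow> complex"
    where F: "\<And>B. F B \<in> finite_rank" "\<And>B. Rep_finrank_unital B = F B + c B *\<^sub>C 1"
    by metis
  define K where "K = F ` (a ` {..<N} \<union> b ` {..<N})"
  have K: "finite K" "K \<subseteq> finite_rank"
    using F(1) by (auto simp: K_def)
  obtain n v \<eta> where bi: "biorthogonal n v \<eta>"
    and fixed: "\<forall>T\<in>K. \<forall>z. proj n v \<eta> (app T z) = app T z \<and> app T (proj n v \<eta> z) = app T z"
    using biorthogonal_fixing_operators[OF K] by blast
  have eq_mat: "B = mat n (\<lambda>i j. rank_one (v i) (\<eta> j)) (\<lambda>i j. \<eta> i (app (F B) (v j))) + c B *\<^sub>C 1"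
    if "F B \<in> K" for B
    using that fixed by (intro finrank_unital_eq_mat[OF bi F(2)]) simp_all
  show "t \<in> T_Lie TYPE('a finrank_unital)"
    unfolding t
  \<comment> \<open>One system serves all coefficients at once, so they all lie in the same matrix
    algebra plus scalars.\<close>
  proof (rule kernel_in_T[OF rank_one_matrix_units[OF bi] _ _ mu mu_op])
    show "a m = mat n (\<lambda>i j. rank_one (v i) (\<eta> j)) (\<lambda>i j. \<eta> i (app (F (a m)) (v j))) + c (a m) *\<^sub>C 1"
      if "m < N" for m
      using that by (intro eq_mat) (simp add: K_def)
    show "b m = mat n (\<lambda>i j. rank_one (v i) (\<eta> j)) (\<lambda>i j. \<eta> i (app (F (b m)) (v j))) + c (b m) *\<^sub>C 1"
      if "m < N" for m
      using that by (intro eq_mat) (simp add: K_def)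
  qed
qed

end
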